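(* Let $1\leq p<\infty$, $-1/p\leq\lambda<0$, $-Q<\alpha<\infty$, and let $\Phi$ be a nonnegative function. Suppose that there is a constant $C_0$ independent of $y$ such that $\Vert A^{-1}(y)\Vert\leq C_0\Vert A(y)\Vert^{-1}$ for all $y\in\mathrm{supp}(\Phi)$. Then $\mathcal{H}_{\Phi,A}$ is bounded on $\dot{L}^{p,\lambda}(\mathbb{H}^n;|\cdot|_h^{\alpha})$ if and only if $$\int_{\mathbb{H}^n}\frac{\Phi(y)}{|y|_h^{Q}}\Vert A(y)\Vert^{(Q+\alpha)\lambda}\,dy<\infty.$$
   Context: The Heisenberg group $\mathbb{H}^n$ is $\mathbf{R}^{2n}\times\mathbf{R}$ with group law $x\cdot y=\big(x_1+y_1,\dots,x_{2n}+y_{2n},\,x_{2n+1}+y_{2n+1}+2\sum_{j=1}^n(y_jx_{n+j}-x_jy_{n+j})\big)$; the inverse of $x$ is $-x$; Haar measure is Lebesgue measure $dx$. $Q=2n+2$ is the homogeneous dimension. The norm is $|x|_h=\big[(\sum_{i=1}^{2n}x_i^2)^2+x_{2n+1}^2\big]^{1/4}$, the distance is $d(p,q)=|q^{-1}p|_h$, and $B(x,r)=\{y: d(x,y)<r\}$. For a $(2n+1)\times(2n+1)$ real matrix $M$ (acting on $\mathbf{R}^{2n+1}$), $\Vert M\Vert=\sup_{x\in\mathbb{H}^n,\,x\neq0}|Mx|_h/|x|_h$. $A^{-1}(y)$ denotes the inverse matrix of $A(y)$. $\Phi$ is a locally integrable function on $\mathbb{H}^n$, and $A(y)$ is a function on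 $\mathbb{H}^n$ with values in $(2n+1)\times(2n+1)$ matrices with $\det A(y)\neq0$ for almost every $y$ in the support of $\Phi$. The Hausdorff operator is $\mathcal{H}_{\Phi,A}f(x)=\int_{\mathbb{H}^n}\frac{\Phi(y)}{|y|_h^Q}f(A(y)x)\,dy$. For a weight $w$ (a nonnegative locally integrable function on $\mathbb{H}^n$; here $w(x)=|x|_h^\alpha$), put $w(E)=\int_E w(x)\,dx$. For $1\leq p<\infty$ and $-1/p\leq\lambda<0$, the weighted central Morrey space $\dot{L}^{p,\lambda}(\mathbb{H}^n;w)$ consists of $f\in L^p_{loc}(\mathbb{H}^n;w)$ with $\Vert f\Vert_{\dot{L}^{p,\lambda}(\mathbb{H}^n;w)}=\sup_{r>0}\left(\frac{1}{w(B(0,r))^{1+p\lambda}}\int_{B(0,r)}|f(x)|^pw(x)\,dx\right)^{1/p}<\infty$. An operator $T$ is bounded on such a space $X$ if there is a constant $C$ with $\Vert Tf\Vert_X\leq C\Vert f\Vert_X$ for all $f\in X$. *)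

theory Defs
  imports "HOL-Analysis.Analysis"
begin

text \<open>
  With n = CARD('n), the index type has 2n+1 elements: \<open>Inl j\<close> stands for the index j,
  \<open>Inr (Inl j)\<close> for n+j (1 \<open>\<le>\<close> j \<open>\<le>\<close> n), and \<open>Inr (Inr ())\<close> for 2n+1.
\<close>

type_synonym 'n heis = "real ^ ('n + 'n + unit)"
type_synonym 'n heis_mat = "real ^ ('n + 'n + unit) ^ ('n + 'n + unit)"

definition heis_x :: "'n::finite heis \<Rightarrow> 'n \<Rightarrow> real" where
  "heis_x x j = x $ Inl j"

definition heis_y :: "'n::finite heis \<Rightarrow> 'n \<Rightarrow> real" where
  "heis_y x j = x $ Inr (Inl j)"

definition heis_t :: "'n::finite heis \<Rightarrow> real" where
  "heis_t x = x $ Inr (Inr ())"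

definition heis_mult :: "'n::finite heis \<Rightarrow> 'n heis \<Rightarrow> 'n heis" where
  "heis_mult x y = (\<chi> i. case i of
      Inl j \<Rightarrow> heis_x x j + heis_x y j
    | Inr (Inl j) \<Rightarrow> heis_y x j + heis_y y j
    | Inr (Inr _) \<Rightarrow> heis_t x + heis_t y
        + 2 * (\<Sum>j\<in>UNIV. heis_x y j * heis_y x j - heis_x x j * heis_y y j))"

definition heis_inv :: "'n::finite heis \<Rightarrow> 'n heis" where
  "heis_inv x = - x"

definition heis_dim :: "'n::finite itself \<Rightarrow> nat" where
  "heis_dim _ = 2 * CARD('n) + 2"

definition heis_norm :: "'n::finite heis \<Rightarrow> real" where
  "heis_norm x =
     root 4 (((\<Sum>j\<in>UNIV. (heis_x x j)\<^sup>2) + (\<Sum>j\<in>UNIV. (heis_y x j)\<^sup>2))\<^sup>2 + (heis_t x)\<^sup>2)"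

definition heis_dist :: "'n::finite heis \<Rightarrow> 'n heis \<Rightarrow> real" where
  "heis_dist p q = heis_norm (heis_mult (heis_inv q) p)"

definition heis_ball :: "'n::finite heis \<Rightarrow> real \<Rightarrow> 'n heis set" where
  "heis_ball x r = {y. heis_dist x y < r}"

text \<open>
  Since the homogeneous norm scales differently in the last coordinate, this supremum is infinite
  for matrices mixing the last coordinate with the others.
\<close>

definition heis_matnorm :: "'n::finite heis_mat \<Rightarrow> ennreal" where
  "heis_matnorm M = (SUP x\<in>{x. x \<noteq> 0}. ennreal (heis_norm (M *v x) / heis_norm x))"

definition ennreal_powr :: "ennreal \<Rightarrow> real \<Rightarrow> ennreal" where
  "ennreal_powr x a =
     (if a = 0 then 1
      else if x = 0 then (if a > 0 then 0 else \<infinity>)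
      else if x = \<infinity> then (if a > 0 then \<infinity> else 0)
      else ennreal (enn2real x powr a))"

definition locally_integrable :: "('a::euclidean_space \<Rightarrow> real) \<Rightarrow> bool" where
  "locally_integrable f \<longleftrightarrow> (\<forall>K. compact K \<longrightarrow> set_integrable lebesgue K f)"

definition weight_of :: "('n::finite heis \<Rightarrow> real) \<Rightarrow> 'n heis set \<Rightarrow> ennreal" where
  "weight_of w E = (\<integral>\<^sup>+x\<in>E. ennreal (w x) \<partial>lebesgue)"

definition Lp_loc :: "real \<Rightarrow> ('n::finite heis \<Rightarrow> real) \<Rightarrow> ('n heis \<Rightarrow> complex) set" where
  "Lp_loc p w = {f. f \<in> borel_measurable lebesgue \<and>
     (\<forall>K. compact K \<longrightarrow> (\<integral>\<^sup>+x\<in>K. ennreal (cmod (f x) powr p * w x) \<partial>lebesgue) < \<infinity>)}"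

definition morrey_norm ::
  "real \<Rightarrow> real \<Rightarrow> ('n::finite heis \<Rightarrow> real) \<Rightarrow> ('n heis \<Rightarrow> complex) \<Rightarrow> ennreal" where
  "morrey_norm p l w f = (SUP r\<in>{0<..}.
     ennreal_powr
       (1 / ennreal_powr (weight_of w (heis_ball 0 r)) (1 + p * l)
         * (\<integral>\<^sup>+x\<in>heis_ball 0 r. ennreal (cmod (f x) powr p * w x) \<partial>lebesgue))
       (1 / p))"

definition morrey_space ::
  "real \<Rightarrow> real \<Rightarrow> ('n::finite heis \<Rightarrow> real) \<Rightarrow> ('n heis \<Rightarrow> complex) set" where
  "morrey_space p l w = {f \<in> Lp_loc p w. morrey_norm p l w f < \<infinity>}"

definition supp :: "('n::finite heis \<Rightarrow> real) \<Rightarrow> 'n heis set" where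
  "supp \<Phi> = closure {y. \<Phi> y \<noteq> 0}"

definition hausdorff_integrand ::
  "('n::finite heis \<Rightarrow> real) \<Rightarrow> ('n heis \<Rightarrow> 'n heis_mat) \<Rightarrow> ('n heis \<Rightarrow> complex)
     \<Rightarrow> 'n heis \<Rightarrow> 'n heis \<Rightarrow> complex" where
  "hausdorff_integrand \<Phi> A f x y =
     of_real (\<Phi> y / heis_norm y ^ heis_dim TYPE('n)) * f (A y *v x)"

definition hausdorff_op ::
  "('n::finite heis \<Rightarrow> real) \<Rightarrow> ('n heis \<Rightarrow> 'n heis_mat) \<Rightarrow> ('n heis \<Rightarrow> complex)
     \<Rightarrow> 'n heis \<Rightarrow> complex" where
  "hausdorff_op \<Phi> A f x = integral\<^sup>L lebesgue (hausdorff_integrand \<Phi> A f x)"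

text \<open>
  The Bochner integral of a non-integrable function is 0 by convention, so boundedness has to
  demand explicitly that the integral defining the operator exists at almost every point.
\<close>

definition hausdorff_bounded ::
  "('n::finite heis \<Rightarrow> real) \<Rightarrow> ('n heis \<Rightarrow> 'n heis_mat)
     \<Rightarrow> ('n heis \<Rightarrow> complex) set \<Rightarrow> (('n heis \<Rightarrow> complex) \<Rightarrow> ennreal) \<Rightarrow> bool" where
  "hausdorff_bounded \<Phi> A X N \<longleftrightarrow> (\<exists>C::real. \<forall>f\<in>X.
     (AE x in lebesgue. integrable lebesgue (hausdorff_integrand \<Phi> A f x)) \<and>
     hausdorff_op \<Phi> A f \<in> X \<and>
     N (hausdorff_op \<Phi> A f) \<le> ennreal C * N f)"

end

theory Submission
  imports Defs
begin

text \<open>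
  Write \<open>N\<close> for the homogeneous norm, \<open>Q\<close> for the homogeneous dimension, \<open>\<gamma> = Q + \<alpha>\<close> and
  \<open>a(y) = \<parallel>A(y)\<parallel>\<close>. The hypothesis \<open>\<parallel>A(y)\<^sup>-\<^sup>1\<parallel> \<le> C\<^sub>0 \<parallel>A(y)\<parallel>\<^sup>-\<^sup>1\<close> says that \<open>N(A(y)x)\<close> is
  comparable to \<open>a(y) N(x)\<close>, uniformly in \<open>x\<close> and \<open>y\<close>: up to constants \<open>A(y)\<close> acts like the
  dilation by \<open>a(y)\<close> (\<open>quasi_dilation_matnorm\<close>). Composing with a dilation by \<open>a\<close> multiplies the
  Morrey norm by exactly \<open>a\<^sup>\<gamma>\<^sup>l\<close>, since the measure \<open>N\<^sup>\<alpha> dx\<close> is homogeneous of degree \<open>\<gamma>\<close>. So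
  \<open>f \<mapsto> f(A(y) \<cdot>)\<close> has norm of the order \<open>a(y)\<^sup>\<gamma>\<^sup>l\<close>, and the integral in the theorem is the sum of
  these norms against the kernel of the operator.

  If the integral is finite, boundedness is the triangle inequality for integrals. It is obtained
  here from a pointwise Jensen inequality for the finite measure with density \<open>\<Phi> N\<^sup>-\<^sup>Q a\<^sup>\<gamma>\<^sup>l\<close>, followed by
  Tonelli (\<open>hausdorff_average_bound\<close>); this weight makes all the maps \<open>f \<mapsto> a(y)\<^sup>-\<^sup>\<gamma>\<^sup>l f(A(y) \<cdot>)\<close>
  uniformly bounded, and Jensen also gives the existence of the integral defining the operator. The
  bound on \<open>f(A(y) \<cdot>)\<close> needs a change of variables under \<open>A(y)\<close>; instead of computing a determinant,
  the Jacobian factor is estimated by comparing the volume of a ball with that of its preimage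
  (\<open>nn_integral_linear_proportional\<close>, \<open>nn_integral_quasi_dilation\<close>).

  Conversely, the function \<open>N\<^sup>\<gamma>\<^sup>l\<close> would be an eigenfunction of composition with dilations, hence a
  natural test function, but it is not in the space when \<open>l = - 1 / p\<close>. For \<open>e > 0\<close> the function
  \<open>f\<^sub>e\<close> equal to \<open>N\<^sup>\<gamma>\<^sup>l\<^sup>-\<^sup>e\<close> on \<open>N \<ge> 1\<close> and \<open>0\<close> elsewhere always is. For it the operator dominates a
  multiple of a dilate: with \<open>m = \<integral> \<Phi> N\<^sup>-\<^sup>Q a\<^sup>\<gamma>\<^sup>l\<^sup>-\<^sup>e\<close> over the set \<open>a \<ge> C\<^sub>0 d\<close>, the image of \<open>f\<^sub>e\<close> is at
  least \<open>m d\<^sup>e\<^sup>-\<^sup>\<gamma>\<^sup>l f\<^sub>e(dilation by d)\<close>. The scaling of the norm cancels the unknown norm of \<open>f\<^sub>e\<close> and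
  leaves \<open>m \<le> c d\<^sup>-\<^sup>e\<close>, where \<open>c\<close> is the operator bound
  (\<open>hausdorff_bounded_truncated_integral_le\<close>). For \<open>d = e = 1 / n\<close> the right-hand side is at most
  \<open>2 c\<close>, and Fatou's lemma concludes as \<open>n \<rightarrow> \<infinity>\<close>.
\<close>

section \<open>The homogeneous norm\<close>

lemma heis_norm_nonneg [simp]: "0 \<le> heis_norm x"
  unfolding heis_norm_def by (intro real_root_ge_zero) auto

lemma heis_norm_pow4:
  "heis_norm x ^ 4 = ((\<Sum>j\<in>UNIV. (heis_x x j)\<^sup>2) + (\<Sum>j\<in>UNIV. (heis_y x j)\<^sup>2))\<^sup>2 + (heis_t x)\<^sup>2"
  unfolding heis_norm_def by (rule real_root_pow_pos2) auto

lemma norm_heis_sq: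
  fixes x :: "'n::finite heis"
  shows "(norm x)\<^sup>2 = (\<Sum>j\<in>UNIV. (heis_x x j)\<^sup>2) + (\<Sum>j\<in>UNIV. (heis_y x j)\<^sup>2) + (heis_t x)\<^sup>2"
proof -
  have "(norm x)\<^sup>2 = (\<Sum>i\<in>UNIV. (x $ i)\<^sup>2)"
    by (simp add: norm_vec_def L2_set_def sum_nonneg)
  also have "\<dots> = (\<Sum>j\<in>UNIV. (heis_x x j)\<^sup>2) + (\<Sum>j\<in>UNIV. (heis_y x j)\<^sup>2) + (heis_t x)\<^sup>2"
    unfolding UNIV_Plus_UNIV[symmetric] heis_x_def heis_y_def heis_t_def
    by (subst sum.Plus, simp, simp, subst sum.Plus) (auto simp: UNIV_unit)
  finally show ?thesis .
qed

text \<open>Only one direction of the comparison with the Euclidean norm is recorded: it makes homogeneous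
  balls bounded, hence of finite volume.\<close>
lemma norm_sq_le_heis_norm:
  fixes x :: "'n::finite heis"
  shows "(norm x)\<^sup>2 \<le> (heis_norm x)\<^sup>2 + heis_norm x ^ 4"
proof -
  define \<rho> where "\<rho> = (\<Sum>j\<in>UNIV. (heis_x x j)\<^sup>2) + (\<Sum>j\<in>UNIV. (heis_y x j)\<^sup>2)"
  have 4: "heis_norm x ^ 4 = \<rho>\<^sup>2 + (heis_t x)\<^sup>2"
    by (simp add: heis_norm_pow4 \<rho>_def)
  then have "\<rho>\<^sup>2 \<le> ((heis_norm x)\<^sup>2)\<^sup>2"
    by simp
  then have "\<rho> \<le> (heis_norm x)\<^sup>2"
    by (rule power2_le_imp_le) simp
  moreover have "(heis_t x)\<^sup>2 \<le> heis_norm x ^ 4"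
    using 4 by simp
  ultimately show ?thesis
    using norm_heis_sq[of x] by (simp add: \<rho>_def)
qed

lemma heis_norm_0 [simp]: "heis_norm 0 = 0"
  unfolding heis_norm_def heis_x_def heis_y_def heis_t_def by simp

lemma heis_norm_eq_0_iff [simp]: "heis_norm x = 0 \<longleftrightarrow> x = 0"
proof
  assume "heis_norm x = 0"
  with norm_sq_le_heis_norm[of x] show "x = 0" by simp
qed simp

lemma heis_norm_pos_iff [simp]: "0 < heis_norm x \<longleftrightarrow> x \<noteq> 0"
  using heis_norm_nonneg[of x] heis_norm_eq_0_iff[of x] by linarith

lemma heis_norm_uminus [simp]: "heis_norm (- x) = heis_norm x"
  unfolding heis_norm_def heis_x_def heis_y_def heis_t_def by simp

lemma continuous_heis_norm [continuous_intros]: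
  "continuous_on S f \<Longrightarrow> continuous_on S (\<lambda>x. heis_norm (f x))"
  unfolding heis_norm_def heis_x_def heis_y_def heis_t_def
  by (intro continuous_intros)

lemma borel_measurable_heis_norm [measurable]: "heis_norm \<in> borel_measurable borel"
  by (intro borel_measurable_continuous_onI continuous_intros)

lemma heis_ball_0: "heis_ball 0 r = {x::'n::finite heis. heis_norm x < r}"
proof -
  have "heis_mult (heis_inv y) 0 = - y" for y :: "'n heis"
    by (auto simp: heis_mult_def heis_inv_def vec_eq_iff heis_x_def heis_y_def heis_t_def
        split: sum.split)
  then show ?thesis
    by (simp add: heis_ball_def heis_dist_def)
qed

lemma heis_norm_bounded_on_compact:
  fixes K :: "'n::finite heis set"
  assumes "compact K"
  obtains r where "0 < r" "K \<subseteq> heis_ball 0 r"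
proof -
  have "compact (heis_norm ` K)"
    by (intro compact_continuous_image continuous_intros assms)
  then obtain B where "\<And>x. x \<in> K \<Longrightarrow> norm (heis_norm x) \<le> B"
    by (meson bounded_iff compact_imp_bounded imageI)
  then have "K \<subseteq> heis_ball 0 (\<bar>B\<bar> + 1)"
    unfolding heis_ball_0 by force
  then show thesis
    by (intro that[of "\<bar>B\<bar> + 1"]) auto
qed

lemma emeasure_heis_ball_finite: "emeasure lborel {x::'n::finite heis. heis_norm x < r} < \<infinity>"
proof (rule emeasure_bounded_finite)
  have "norm x \<le> sqrt (r\<^sup>2 + r ^ 4)" if "heis_norm x < r" for x :: "'n heis"
  proof -
    have "(heis_norm x)\<^sup>2 \<le> r\<^sup>2" "heis_norm x ^ 4 \<le> r ^ 4"
      using that by (auto intro!: power_mono)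
    with norm_sq_le_heis_norm[of x] show ?thesis
      by (intro real_le_rsqrt) linarith
  qed
  then show "bounded {x::'n heis. heis_norm x < r}"
    by (auto simp: bounded_iff)
qed

text \<open>Almost-everywhere statements are instantiated at a point of a nonempty open set through this
  lemma.\<close>
lemma not_AE_not_in_open:
  fixes S :: "'a::euclidean_space set"
  assumes "open S" "S \<noteq> {}"
  shows "\<not> (AE x in lborel. x \<notin> S)"
proof
  assume "AE x in lborel. x \<notin> S"
  then have "S \<in> null_sets lborel"
    using assms by (subst AE_iff_null_sets) auto
  then have "negligible S"
    by (simp add: negligible_iff_null_sets null_sets_completionI)
  with open_not_negligible assms show False by blast
qed

section \<open>Dilations\<close>

definition heis_dil :: "real \<Rightarrow> 'n::finite heis \<Rightarrow> 'n heis" where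
  "heis_dil s x = (\<chi> i. (if i = Inr (Inr ()) then s\<^sup>2 else s) * x $ i)"

lemma heis_norm_dil [simp]:
  assumes "0 \<le> s"
  shows "heis_norm (heis_dil s x) = s * heis_norm x"
proof -
  have "heis_norm (heis_dil s x) ^ 4 = (s * heis_norm x) ^ 4"
    unfolding power_mult_distrib heis_norm_pow4
    by (simp add: heis_dil_def heis_x_def heis_y_def heis_t_def power_mult_distrib
        flip: sum_distrib_left distrib_left power_mult)
  then show ?thesis
    using assms by (simp add: power_eq_iff_eq_base)
qed

lemma borel_measurable_heis_dil [measurable]: "heis_dil s \<in> borel_measurable borel"
  unfolding heis_dil_def
  by (intro borel_measurable_continuous_onI continuous_intros)

lemma exists_heis_norm_eq:
  assumes "0 \<le> r"
  obtains x :: "'n::finite heis" where "heis_norm x = r"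
proof -
  let ?e = "axis undefined 1 :: 'n heis"
  have "?e \<noteq> 0" by (simp add: axis_eq_0_iff)
  then have "heis_norm (heis_dil (r / heis_norm ?e) ?e) = r"
    using assms by simp
  then show thesis by (rule that)
qed

abbreviation (input) hdim :: "'n::finite itself \<Rightarrow> real" where
  "hdim T \<equiv> real (heis_dim T)"

text \<open>The Jacobian is the product of \<open>2 n\<close> factors \<open>s\<close> and one factor \<open>s\<^sup>2\<close>, which is where the
  homogeneous dimension comes from.\<close>
lemma nn_integral_heis_dil:
  fixes f :: "'n::finite heis \<Rightarrow> ennreal"
  assumes s: "0 < s" and [measurable]: "f \<in> borel_measurable borel"
  shows "(\<integral>\<^sup>+x. f x \<partial>lborel) = ennreal (s powr hdim TYPE('n)) * (\<integral>\<^sup>+x. f (heis_dil s x) \<partial>lborel)"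
proof -
  define m :: "'n + 'n + unit \<Rightarrow> real" where "m i = (if i = Inr (Inr ()) then s\<^sup>2 else s)" for i
  \<comment> \<open>The affine change of variables takes its factors indexed by basis vectors rather than by
     coordinates.\<close>
  define c :: "'n heis \<Rightarrow> real" where "c b = m (SOME i. b = axis i 1)" for b
  have c: "c (axis i 1) = m i" for i
    by (simp add: c_def axis_eq_axis)
  have T: "(\<lambda>x. 0 + (\<Sum>j\<in>Basis. (c j * (x \<bullet> j)) *\<^sub>R j)) = heis_dil s"
  proof
    fix x :: "'n heis"
    have "(\<Sum>j\<in>Basis. (c j * (x \<bullet> j)) *\<^sub>R j) \<bullet> b = heis_dil s x \<bullet> b" if "b \<in> Basis" for b
    proof -
      from that obtain i where b: "b = axis i 1"
        by (auto simp: Basis_vec_def)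
      have "(\<Sum>j\<in>Basis. (c j * (x \<bullet> j)) *\<^sub>R j) \<bullet> b = c b * (x \<bullet> b)"
        using that by simp
      also have "\<dots> = heis_dil s x \<bullet> b"
        unfolding b c by (simp add: heis_dil_def m_def inner_axis)
      finally show ?thesis .
    qed
    then show "0 + (\<Sum>j\<in>Basis. (c j * (x \<bullet> j)) *\<^sub>R j) = heis_dil s x"
      by (simp add: euclidean_eq_iff[where 'a="'n heis"])
  qed
  have cpos: "c j > 0" if "j \<in> Basis" for j
    using that s by (auto simp: Basis_vec_def c m_def)
  have bas: "(Basis :: 'n heis set) = range (\<lambda>i. axis i 1)"
    by (auto simp: Basis_vec_def)
  have "(\<Prod>j\<in>Basis. \<bar>c j\<bar>) = (\<Prod>j\<in>Basis. c j)"
    by (intro prod.cong) (auto dest!: cpos)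
  also have "\<dots> = (\<Prod>i\<in>UNIV. m i)"
    unfolding bas by (subst prod.reindex) (auto simp: inj_on_def axis_eq_axis c)
  also have "\<dots> = s ^ heis_dim TYPE('n)"
    unfolding UNIV_Plus_UNIV[symmetric]
    by (subst prod.Plus, simp, simp, subst prod.Plus)
       (auto simp: m_def UNIV_unit heis_dim_def power_add mult_2 power2_eq_square)
  also have "\<dots> = s powr hdim TYPE('n)"
    using s by (simp add: powr_realpow)
  finally have det: "(\<Prod>j\<in>Basis. \<bar>c j\<bar>) = s powr hdim TYPE('n)" .
  have c0: "c j \<noteq> 0" if "j \<in> Basis" for j
    using cpos[OF that] by simp
  have "(lborel :: 'n heis measure) = density (distr lborel borel (heis_dil s)) (\<lambda>_. ennreal (s powr hdim TYPE('n)))"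
    using lborel_affine_euclidean[of c 0, OF c0] unfolding T det .
  then have "(\<integral>\<^sup>+x. f x \<partial>lborel)
     = (\<integral>\<^sup>+x. f x \<partial>density (distr lborel borel (heis_dil s)) (\<lambda>_. ennreal (s powr hdim TYPE('n))))"
    by simp
  also have "\<dots> = ennreal (s powr hdim TYPE('n)) * (\<integral>\<^sup>+x. f (heis_dil s x) \<partial>lborel)"
    by (simp add: nn_integral_density nn_integral_distr nn_integral_cmult)
  finally show ?thesis .
qed

section \<open>Linear changes of variables\<close>

lemma nn_integral_lborel_translate:
  fixes f :: "'a::euclidean_space \<Rightarrow> ennreal"
  assumes [measurable]: "f \<in> borel_measurable borel"
  shows "(\<integral>\<^sup>+x. f (t + x) \<partial>lborel) = (\<integral>\<^sup>+x. f x \<partial>lborel)"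
  by (subst (2) lborel_affine[of 1 t]) (auto simp: nn_integral_density nn_integral_distr)

lemma nn_integral_lborel_reflect:
  fixes f :: "'a::euclidean_space \<Rightarrow> ennreal"
  assumes [measurable]: "f \<in> borel_measurable borel"
  shows "(\<integral>\<^sup>+x. f (t - x) \<partial>lborel) = (\<integral>\<^sup>+x. f x \<partial>lborel)"
  by (subst (2) lborel_affine[of "-1" t]) (auto simp: nn_integral_density nn_integral_distr)

text \<open>
  Uniqueness of translation-invariant measures: \<open>E \<mapsto> volume (L\<^sup>-\<^sup>1 E)\<close> is translation invariant, so it
  is a multiple of the volume. The classical argument by Tonelli expresses both products as
  \<open>\<integral>\<integral> f(L y) g(L y + x) dx dy\<close>, evaluated in the two orders of integration. The factor never has to
  be identified with a determinant: it is read off from a convenient \<open>g\<close>.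
\<close>
lemma nn_integral_linear_proportional:
  fixes L :: "'a::euclidean_space \<Rightarrow> 'a" and f g :: "'a \<Rightarrow> ennreal"
  assumes L: "linear L" "inj L"
    and [measurable]: "f \<in> borel_measurable borel" "g \<in> borel_measurable borel"
  shows "(\<integral>\<^sup>+y. f (L y) \<partial>lborel) * (\<integral>\<^sup>+x. g x \<partial>lborel)
       = (\<integral>\<^sup>+y. g (L y) \<partial>lborel) * (\<integral>\<^sup>+x. f x \<partial>lborel)"
proof -
  have L_meas [measurable]: "L \<in> borel_measurable borel"
    using L(1) by (intro borel_measurable_continuous_onI linear_continuous_on
        linear_conv_bounded_linear[THEN iffD1])
  have "surj L"
    using L linear_injective_imp_surjective by blast
  then obtain R where R: "L (R x) = x" for x
    by (metis surjD)
  have "(\<integral>\<^sup>+y. f (L y) \<partial>lborel) * (\<integral>\<^sup>+x. g x \<partial>lborel)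
      = (\<integral>\<^sup>+y. (\<integral>\<^sup>+x. f (L y) * g x \<partial>lborel) \<partial>lborel)"
    by (simp add: nn_integral_cmult nn_integral_multc)
  also have "\<dots> = (\<integral>\<^sup>+y. (\<integral>\<^sup>+x. f (L y) * g (L y + x) \<partial>lborel) \<partial>lborel)"
    by (simp add: nn_integral_cmult nn_integral_lborel_translate)
  also have "\<dots> = (\<integral>\<^sup>+x. (\<integral>\<^sup>+y. f (L y) * g (L y + x) \<partial>lborel) \<partial>lborel)"
    by (rule lborel_pair.Fubini') measurable
  also have "\<dots> = (\<integral>\<^sup>+x. (\<integral>\<^sup>+y. f (L y - x) * g (L y) \<partial>lborel) \<partial>lborel)"
  proof (rule nn_integral_cong)
    fix x
    have "(\<integral>\<^sup>+y. f (L y) * g (L y + x) \<partial>lborel)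
        = (\<integral>\<^sup>+y. f (L (- R x + y)) * g (L (- R x + y) + x) \<partial>lborel)"
      by (rule nn_integral_lborel_translate[symmetric]) measurable
    also have "\<dots> = (\<integral>\<^sup>+y. f (L y - x) * g (L y) \<partial>lborel)"
      using L(1) by (simp add: linear_diff R)
    finally show "(\<integral>\<^sup>+y. f (L y) * g (L y + x) \<partial>lborel) = \<dots>" .
  qed
  also have "\<dots> = (\<integral>\<^sup>+y. (\<integral>\<^sup>+x. f (L y - x) * g (L y) \<partial>lborel) \<partial>lborel)"
    by (rule lborel_pair.Fubini') measurable
  also have "\<dots> = (\<integral>\<^sup>+y. g (L y) \<partial>lborel) * (\<integral>\<^sup>+x. f x \<partial>lborel)"
    by (simp add: nn_integral_cmult nn_integral_multc nn_integral_lborel_reflect mult.commute)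
  finally show ?thesis .
qed

section \<open>Integrals of powers of the homogeneous norm\<close>

text \<open>
  By homogeneity the integral over the \<open>n\<close>-th shell is \<open>\<sigma>\<^sup>n\<^sup>(\<^sup>Q\<^sup>+\<^sup>\<beta>\<^sup>)\<close> times the integral over the shell
  \<open>1 \<le> N < 2\<close>, so the sum over the shells is a convergent geometric series. The ratio \<open>1/2\<close> exhausts the
  unit ball without the origin, and the ratio \<open>2\<close> exhausts the complement of the unit ball.
\<close>
lemma nn_integral_heis_norm_powr_shells:
  fixes \<sigma> \<beta> :: real
  assumes \<sigma>: "0 < \<sigma>" and small: "\<sigma> powr (hdim TYPE('n::finite) + \<beta>) < 1"
  shows "(\<integral>\<^sup>+x\<in>(\<Union>n::nat. {x::'n heis. \<sigma> ^ n \<le> heis_norm x \<and> heis_norm x < 2 * \<sigma> ^ n}).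
           ennreal (heis_norm x powr \<beta>) \<partial>lborel) < \<infinity>"
proof -
  define S where "S r = {x::'n heis. r \<le> heis_norm x \<and> heis_norm x < 2 * r}" for r
  have S_meas [measurable]: "S r \<in> sets borel" for r
    unfolding S_def by measurable
  define a where "a = (\<integral>\<^sup>+x\<in>S 1. ennreal (heis_norm x powr \<beta>) \<partial>lborel)"
  have "a \<le> (\<integral>\<^sup>+x. ennreal (2 powr \<bar>\<beta>\<bar>) * indicator {x::'n heis. heis_norm x < 2} x \<partial>lborel)"
    unfolding a_def
  proof (intro nn_integral_mono)
    fix x :: "'n heis"
    have "heis_norm x powr \<beta> \<le> 2 powr \<bar>\<beta>\<bar>" if "1 \<le> heis_norm x" "heis_norm x < 2"
    proof -
      have "heis_norm x powr \<beta> \<le> heis_norm x powr \<bar>\<beta>\<bar>"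
        using that by (intro powr_mono) auto
      also have "\<dots> \<le> 2 powr \<bar>\<beta>\<bar>"
        using that by (intro powr_mono2) auto
      finally show ?thesis .
    qed
    then show "ennreal (heis_norm x powr \<beta>) * indicator (S 1) x
        \<le> ennreal (2 powr \<bar>\<beta>\<bar>) * indicator {x. heis_norm x < 2} x"
      by (auto simp: S_def indicator_def intro!: ennreal_leI)
  qed
  also have "\<dots> = ennreal (2 powr \<bar>\<beta>\<bar>) * emeasure lborel {x::'n heis. heis_norm x < 2}"
    by (simp add: nn_integral_cmult)
  also have "\<dots> < \<infinity>"
    using emeasure_heis_ball_finite[of 2, where 'n='n] by (simp add: ennreal_mult_less_top)
  finally have a_fin: "a < \<infinity>" .
  have shell: "(\<integral>\<^sup>+x\<in>S (\<sigma> ^ n). ennreal (heis_norm x powr \<beta>) \<partial>lborel)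
      = ennreal ((\<sigma> powr (hdim TYPE('n) + \<beta>)) ^ n) * a" for n
  proof -
    define s where "s = \<sigma> ^ n"
    have s: "0 < s" using \<sigma> by (simp add: s_def)
    have "(\<integral>\<^sup>+x\<in>S s. ennreal (heis_norm x powr \<beta>) \<partial>lborel)
        = ennreal (s powr hdim TYPE('n)) *
           (\<integral>\<^sup>+x. ennreal (heis_norm (heis_dil s x) powr \<beta>) * indicator (S s) (heis_dil s x :: 'n heis) \<partial>lborel)"
      by (rule nn_integral_heis_dil[OF s]) measurable
    also have "\<dots> = ennreal (s powr hdim TYPE('n)) * (\<integral>\<^sup>+x. ennreal (s powr \<beta>) * (ennreal (heis_norm x powr \<beta>) * indicator (S 1) (x :: 'n heis)) \<partial>lborel)"
    proof (rule arg_cong2[where f="(*)", OF refl nn_integral_cong])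
      fix x :: "'n heis"
      have "indicator (S s) (heis_dil s x) = (indicator (S 1) x :: ennreal)"
        using s by (auto simp: S_def indicator_def mult.commute)
      then show "ennreal (heis_norm (heis_dil s x) powr \<beta>) * indicator (S s) (heis_dil s x)
          = ennreal (s powr \<beta>) * (ennreal (heis_norm x powr \<beta>) * indicator (S 1) x)"
        using s by (simp add: powr_mult ennreal_mult mult.assoc)
    qed
    also have "\<dots> = ennreal (s powr (hdim TYPE('n) + \<beta>)) * a"
      by (simp add: nn_integral_cmult a_def powr_add ennreal_mult mult.assoc)
    also have "s powr (hdim TYPE('n) + \<beta>) = (\<sigma> powr (hdim TYPE('n) + \<beta>)) ^ n"
      using \<sigma> unfolding s_def by (simp add: powr_powr mult.commute flip: powr_realpow)
    finally show ?thesis unfolding s_def .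
  qed
  have "(\<integral>\<^sup>+x\<in>(\<Union>n. S (\<sigma> ^ n)). ennreal (heis_norm x powr \<beta>) \<partial>lborel)
      \<le> (\<integral>\<^sup>+x. (\<Sum>n. ennreal (heis_norm x powr \<beta>) * indicator (S (\<sigma> ^ n)) x) \<partial>lborel)"
  proof (intro nn_integral_mono)
    fix x :: "'n heis"
    show "ennreal (heis_norm x powr \<beta>) * indicator (\<Union>n. S (\<sigma> ^ n)) x
        \<le> (\<Sum>n. ennreal (heis_norm x powr \<beta>) * indicator (S (\<sigma> ^ n)) x)"
    proof (cases "x \<in> (\<Union>n. S (\<sigma> ^ n))")
      case True
      then obtain n where "x \<in> S (\<sigma> ^ n)" by blast
      then show ?thesis
        using sum_le_suminf[of "\<lambda>n. ennreal (heis_norm x powr \<beta>) * indicator (S (\<sigma> ^ n)) x" "{n}"] True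
        by simp
    qed simp
  qed
  also have "\<dots> = (\<Sum>n. ennreal ((\<sigma> powr (hdim TYPE('n) + \<beta>)) ^ n) * a)"
    by (subst nn_integral_suminf) (simp_all add: shell)
  also have "\<dots> = (\<Sum>n. ennreal ((\<sigma> powr (hdim TYPE('n) + \<beta>)) ^ n)) * a"
    by simp
  also have "(\<Sum>n. ennreal ((\<sigma> powr (hdim TYPE('n) + \<beta>)) ^ n)) = ennreal (\<Sum>n. (\<sigma> powr (hdim TYPE('n) + \<beta>)) ^ n)"
    by (rule suminf_ennreal2) (use small in \<open>auto intro!: summable_geometric\<close>)
  also have "\<dots> * a < \<infinity>"
    using a_fin by (simp add: ennreal_mult_less_top)
  finally show ?thesis
    unfolding S_def .
qed

lemma nn_integral_heis_norm_powr_near_0: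
  assumes "- hdim TYPE('n::finite) < \<beta>"
  shows "(\<integral>\<^sup>+x\<in>{x::'n heis. heis_norm x < 1}. ennreal (heis_norm x powr \<beta>) \<partial>lborel) < \<infinity>"
proof -
  have "\<exists>n::nat. (1/2) ^ n \<le> t \<and> t < 2 * (1/2) ^ n" if t: "0 < t" "t < 1" for t :: real
  proof -
    define n where "n = (LEAST n. (1/2) ^ n \<le> t)"
    have ex: "\<exists>n. (1/2) ^ n \<le> t"
      using real_arch_pow_inv[of t "1/2"] t by (auto intro: less_imp_le)
    then have le: "(1/2) ^ n \<le> t"
      unfolding n_def by (rule LeastI_ex)
    then obtain m where m: "n = Suc m"
      using t by (cases n) auto
    have "\<not> (1/2) ^ m \<le> t"
      using not_less_Least[of m "\<lambda>n. (1/2) ^ n \<le> t"] m by (simp add: n_def)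
    then show ?thesis
      using le m by (intro exI[of _ n]) auto
  qed
  then have "x = 0 \<or> x \<in> (\<Union>n::nat. {x::'n heis. (1/2) ^ n \<le> heis_norm x \<and> heis_norm x < 2 * (1/2) ^ n})"
    if "heis_norm x < 1" for x :: "'n heis"
    using that heis_norm_pos_iff[of x] by blast
  then have "(\<integral>\<^sup>+x\<in>{x::'n heis. heis_norm x < 1}. ennreal (heis_norm x powr \<beta>) \<partial>lborel)
     \<le> (\<integral>\<^sup>+x\<in>(\<Union>n::nat. {x::'n heis. (1/2) ^ n \<le> heis_norm x \<and> heis_norm x < 2 * (1/2) ^ n}).
           ennreal (heis_norm x powr \<beta>) \<partial>lborel)"
    by (intro nn_integral_mono) (fastforce simp: indicator_def)
  also have "\<dots> < \<infinity>"
    using assms powr_less_mono'[of "1/2" 0 "hdim TYPE('n) + \<beta>"]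
    by (intro nn_integral_heis_norm_powr_shells) auto
  finally show ?thesis .
qed

lemma nn_integral_heis_norm_powr_at_infinity:
  assumes "\<beta> < - hdim TYPE('n::finite)"
  shows "(\<integral>\<^sup>+x\<in>{x::'n heis. 1 \<le> heis_norm x}. ennreal (heis_norm x powr \<beta>) \<partial>lborel) < \<infinity>"
proof -
  have "\<exists>n::nat. 2 ^ n \<le> t \<and> t < 2 * 2 ^ n" if t: "1 \<le> t" for t :: real
  proof -
    define n where "n = (LEAST n. t < 2 * 2 ^ n)"
    obtain k where "t < 2 ^ k"
      using real_arch_pow[of 2 t] by auto
    then have ex: "\<exists>n. t < 2 * 2 ^ n"
      by (intro exI[of _ k]) (smt (verit) zero_less_power)
    then have less: "t < 2 * 2 ^ n"
      unfolding n_def by (rule LeastI_ex)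
    have "2 ^ n \<le> t"
    proof (cases n)
      case (Suc m)
      then have "\<not> t < 2 * 2 ^ m"
        using not_less_Least[of m "\<lambda>n. t < 2 * 2 ^ n"] by (simp add: n_def)
      then show ?thesis using Suc by simp
    qed (use t in auto)
    then show ?thesis using less by blast
  qed
  then have "(\<integral>\<^sup>+x\<in>{x::'n heis. 1 \<le> heis_norm x}. ennreal (heis_norm x powr \<beta>) \<partial>lborel)
     \<le> (\<integral>\<^sup>+x\<in>(\<Union>n::nat. {x::'n heis. 2 ^ n \<le> heis_norm x \<and> heis_norm x < 2 * 2 ^ n}).
           ennreal (heis_norm x powr \<beta>) \<partial>lborel)"
    by (intro nn_integral_mono) (auto simp: indicator_def)
  also have "\<dots> < \<infinity>"
    using assms powr_less_mono[of "hdim TYPE('n) + \<beta>" 0 2]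
    by (intro nn_integral_heis_norm_powr_shells) auto
  finally show ?thesis .
qed

lemma heis_ball_pow_weight:
  fixes \<alpha> :: real
  assumes \<alpha>: "- hdim TYPE('n::finite) < \<alpha>"
  shows "\<exists>W>0. \<forall>r>0. (\<integral>\<^sup>+x\<in>{x::'n heis. heis_norm x < r}. ennreal (heis_norm x powr \<alpha>) \<partial>lborel)
        = ennreal (W * r powr (hdim TYPE('n) + \<alpha>))"
proof -
  define I where "I r = (\<integral>\<^sup>+x\<in>{x::'n heis. heis_norm x < r}. ennreal (heis_norm x powr \<alpha>) \<partial>lborel)" for r
  define W where "W = enn2real (I 1)"
  have I1: "I 1 = ennreal W"
    using nn_integral_heis_norm_powr_near_0[OF \<alpha>] by (simp add: W_def I_def)
  have "I 1 \<noteq> 0"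
  proof
    assume "I 1 = 0"
    then have "AE x in lborel. ennreal (heis_norm x powr \<alpha>) * indicator {x::'n heis. heis_norm x < 1} x = 0"
      unfolding I_def by (subst (asm) nn_integral_0_iff_AE) auto
    then have "AE x in lborel. x \<notin> {x::'n heis. 0 < heis_norm x \<and> heis_norm x < 1}"
      by eventually_elim (auto simp: indicator_def)
    moreover have "open {x::'n heis. 0 < heis_norm x \<and> heis_norm x < 1}"
      by (intro open_Collect_conj open_Collect_less continuous_intros)
    moreover obtain x :: "'n heis" where "heis_norm x = 1/2"
      using exists_heis_norm_eq[of "1/2"] by auto
    then have "x \<in> {x::'n heis. 0 < heis_norm x \<and> heis_norm x < 1}"
      by (simp del: heis_norm_pos_iff)
    ultimately show False
      using not_AE_not_in_open by blast
  qed
  then have "0 < W"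
    using I1 by (simp add: ennreal_eq_0_iff)
  moreover have "I r = ennreal (W * r powr (hdim TYPE('n) + \<alpha>))" if r: "0 < r" for r
  proof -
    have "I r = ennreal (r powr hdim TYPE('n)) *
           (\<integral>\<^sup>+x. ennreal (heis_norm (heis_dil r x) powr \<alpha>) * indicator {x. heis_norm x < r} (heis_dil r x :: 'n heis) \<partial>lborel)"
      unfolding I_def by (rule nn_integral_heis_dil[OF r]) measurable
    also have "\<dots> = ennreal (r powr hdim TYPE('n)) * (\<integral>\<^sup>+x. ennreal (r powr \<alpha>) * (ennreal (heis_norm x powr \<alpha>) * indicator {x. heis_norm x < 1} (x :: 'n heis)) \<partial>lborel)"
      using r by (intro arg_cong2[where f="(*)", OF refl nn_integral_cong])
        (simp add: powr_mult ennreal_mult mult.assoc indicator_def)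
    also have "\<dots> = ennreal (r powr (hdim TYPE('n) + \<alpha>)) * I 1"
      by (simp add: nn_integral_cmult I_def powr_add ennreal_mult mult.assoc)
    finally show ?thesis
      using \<open>0 < W\<close> by (simp add: I1 ennreal_mult mult.commute)
  qed
  ultimately show ?thesis
    unfolding I_def by blast
qed

section \<open>Matrices comparable to a dilation\<close>

text \<open>
  The form in which the hypothesis on \<open>A\<close> is used: it avoids inverse matrices and the value \<open>\<infinity>\<close> of the
  matrix norm, and it holds for the dilation by \<open>a\<close> with constant \<open>C = 1\<close>.
\<close>
definition quasi_dilation :: "real \<Rightarrow> real \<Rightarrow> 'n::finite heis_mat \<Rightarrow> bool" where
  "quasi_dilation C a M \<longleftrightarrow> 0 < a \<and>
     (\<forall>x. heis_norm (M *v x) \<le> a * heis_norm x \<and> a * heis_norm x \<le> C * heis_norm (M *v x))"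

lemma quasi_dilationD:
  assumes "quasi_dilation C a M"
  shows "0 < a" "heis_norm (M *v x) \<le> a * heis_norm x" "a * heis_norm x \<le> C * heis_norm (M *v x)"
  using assms by (auto simp: quasi_dilation_def)

lemma quasi_dilation_const_ge_1:
  fixes M :: "'n::finite heis_mat"
  assumes "quasi_dilation C a M"
  shows "1 \<le> C"
proof -
  note D = quasi_dilationD[OF assms]
  obtain x :: "'n heis" where x: "heis_norm x = 1"
    using exists_heis_norm_eq[of 1] by auto
  have pos: "0 < C * heis_norm (M *v x)"
    using D(1) D(3)[of x] x by simp
  then have "0 < C"
    using heis_norm_nonneg[of "M *v x"] by (simp add: zero_less_mult_iff)
  then have "a \<le> C * a"
    using D(2,3)[of x] mult_left_mono[of "heis_norm (M *v x)" a C] unfolding x by linarith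
  then show ?thesis
    using D(1) by simp
qed

lemma quasi_dilation_heis_norm_ge:
  assumes "quasi_dilation C a M"
  shows "a / C * heis_norm x \<le> heis_norm (M *v x)"
  using quasi_dilationD(3)[OF assms, of x] quasi_dilation_const_ge_1[OF assms]
  by (simp add: field_simps)

text \<open>
  The Jacobian factor of \<open>M\<close> is the ratio of the volumes of the preimage of the unit ball and of the
  unit ball. The preimage lies in the ball of radius \<open>C / a\<close>, whose volume is known by dilation.
\<close>
lemma nn_integral_quasi_dilation:
  fixes M :: "'n::finite heis_mat"
  assumes M: "quasi_dilation C a M" and f [measurable]: "f \<in> borel_measurable borel"
  shows "(\<integral>\<^sup>+x. f (M *v x) \<partial>lborel) \<le> ennreal ((C / a) powr hdim TYPE('n)) * (\<integral>\<^sup>+x. f x \<partial>lborel)"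
proof -
  note D = quasi_dilationD[OF M]
  have C: "1 \<le> C" by (rule quasi_dilation_const_ge_1[OF M])
  let ?B = "{x::'n heis. heis_norm x < 1}"
  let ?r = "C / a"
  have r: "0 < ?r" using C D(1) by simp
  have inj: "inj ((*v) M)"
  proof (rule linear_injective_0[THEN iffD2, rule_format])
    show "linear ((*v) M)" by simp
    fix x assume "M *v x = 0"
    with D(3)[of x] have "a * heis_norm x \<le> 0"
      by simp
    with D(1) have "heis_norm x \<le> 0"
      by (simp add: mult_le_0_iff)
    then show "x = 0"
      using heis_norm_nonneg[of x] heis_norm_eq_0_iff[of x] by linarith
  qed
  have "(\<integral>\<^sup>+x. f (M *v x) \<partial>lborel) * emeasure lborel ?B
      = (\<integral>\<^sup>+x. f (M *v x) \<partial>lborel) * (\<integral>\<^sup>+x. indicator ?B x \<partial>lborel)"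
    by simp
  also have "\<dots> = (\<integral>\<^sup>+x. indicator ?B (M *v x) \<partial>lborel) * (\<integral>\<^sup>+x. f x \<partial>lborel)"
    by (rule nn_integral_linear_proportional[OF _ inj]) auto
  finally have eq: "(\<integral>\<^sup>+x. f (M *v x) \<partial>lborel) * emeasure lborel ?B
      = (\<integral>\<^sup>+x. indicator ?B (M *v x) \<partial>lborel) * (\<integral>\<^sup>+x. f x \<partial>lborel)" .
  have "(\<integral>\<^sup>+x. indicator ?B (M *v x) \<partial>lborel) \<le> (\<integral>\<^sup>+x. indicator {x::'n heis. heis_norm x < ?r} x \<partial>lborel)"
  proof (intro nn_integral_mono)
    fix x :: "'n heis"
    have "heis_norm x < ?r" if "heis_norm (M *v x) < 1"
    proof -
      have "a * heis_norm x \<le> C * heis_norm (M *v x)" by (rule D)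
      also have "\<dots> < C * 1" using that C by (intro mult_strict_left_mono) auto
      finally show ?thesis using D(1) by (simp add: field_simps)
    qed
    then show "(indicator ?B (M *v x) :: ennreal) \<le> indicator {x. heis_norm x < ?r} x"
      by (auto simp: indicator_def)
  qed
  also have "\<dots> = ennreal (?r powr hdim TYPE('n)) * (\<integral>\<^sup>+x. indicator {x::'n heis. heis_norm x < ?r} (heis_dil ?r x) \<partial>lborel)"
    by (rule nn_integral_heis_dil[OF r]) measurable
  also have "(\<lambda>x. indicator {x::'n heis. heis_norm x < ?r} (heis_dil ?r x)) = (indicator ?B :: _ \<Rightarrow> ennreal)"
    using r by (auto simp: indicator_def fun_eq_iff mult_less_cancel_left_pos[of ?r _ 1, simplified])
  also have "(\<integral>\<^sup>+x. indicator ?B x \<partial>lborel) = emeasure lborel ?B"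
    by simp
  finally have "(\<integral>\<^sup>+x. indicator ?B (M *v x) \<partial>lborel) \<le> ennreal (?r powr hdim TYPE('n)) * emeasure lborel ?B" .
  then have "emeasure lborel ?B * (\<integral>\<^sup>+x. f (M *v x) \<partial>lborel)
      \<le> (ennreal (?r powr hdim TYPE('n)) * emeasure lborel ?B) * (\<integral>\<^sup>+x. f x \<partial>lborel)"
    unfolding mult.commute[of "emeasure lborel ?B" "\<integral>\<^sup>+x. f (M *v x) \<partial>lborel"] eq by (rule mult_right_mono) simp
  also have "\<dots> = emeasure lborel ?B * (ennreal (?r powr hdim TYPE('n)) * (\<integral>\<^sup>+x. f x \<partial>lborel))"
    by (simp only: mult_ac)
  finally have "emeasure lborel ?B * (\<integral>\<^sup>+x. f (M *v x) \<partial>lborel)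
      \<le> emeasure lborel ?B * (ennreal (?r powr hdim TYPE('n)) * (\<integral>\<^sup>+x. f x \<partial>lborel))" .
  moreover have "emeasure lborel ?B < \<infinity>"
    by (rule emeasure_heis_ball_finite)
  moreover have "emeasure lborel ?B \<noteq> 0"
  proof
    assume "emeasure lborel ?B = 0"
    then have "AE x in lborel. x \<notin> ?B"
      by (subst AE_iff_null_sets[symmetric]) auto
    moreover have "open ?B" by (intro open_Collect_less continuous_intros)
    moreover have "0 \<in> ?B" by simp
    ultimately show False using not_AE_not_in_open by blast
  qed
  ultimately show ?thesis
    by (subst (asm) ennreal_mult_le_mult_iff) auto
qed

text \<open>
  The weight transforms by \<open>N(x)\<^sup>\<alpha> \<le> C\<^sup>|\<^sup>\<alpha>\<^sup>| a\<^sup>-\<^sup>\<alpha> N(M x)\<^sup>\<alpha>\<close>: for \<open>\<alpha> \<ge> 0\<close> this is the lower bound on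
  \<open>N(M x)\<close>, for \<open>\<alpha> < 0\<close> the upper bound.
\<close>
lemma weighted_nn_integral_quasi_dilation:
  fixes M :: "'n::finite heis_mat"
  assumes M: "quasi_dilation C a M" and f [measurable]: "f \<in> borel_measurable borel"
  shows "(\<integral>\<^sup>+x\<in>{x. heis_norm x < r}. f (M *v x) * ennreal (heis_norm x powr \<alpha>) \<partial>lborel)
     \<le> ennreal (C powr (hdim TYPE('n) + \<bar>\<alpha>\<bar>) * a powr - (hdim TYPE('n) + \<alpha>))
         * (\<integral>\<^sup>+x\<in>{x. heis_norm x < a * r}. f x * ennreal (heis_norm x powr \<alpha>) \<partial>lborel)"
proof -
  note D = quasi_dilationD[OF M]
  have C: "1 \<le> C" by (rule quasi_dilation_const_ge_1[OF M])
  have wt: "heis_norm x powr \<alpha> \<le> C powr \<bar>\<alpha>\<bar> * a powr - \<alpha> * heis_norm (M *v x) powr \<alpha>" for x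
  proof (cases "x = 0")
    case False
    then have "0 < a * heis_norm x" using D(1) by simp
    then have Mx: "0 < heis_norm (M *v x)"
      using D(2,3)[of x] C by (smt (verit) heis_norm_nonneg mult_eq_0_iff)
    show ?thesis
    proof (cases "0 \<le> \<alpha>")
      case True
      have "(a * heis_norm x) powr \<alpha> \<le> (C * heis_norm (M *v x)) powr \<alpha>"
        using True D(1) D(3)[of x] by (intro powr_mono2) auto
      then show ?thesis
        using True C D(1) by (simp add: powr_mult powr_minus field_simps)
    next
      case neg: False
      have "(a * heis_norm x) powr \<alpha> \<le> heis_norm (M *v x) powr \<alpha>"
        using neg Mx D(2)[of x] by (intro powr_mono2') auto
      also have "\<dots> \<le> C powr \<bar>\<alpha>\<bar> * heis_norm (M *v x) powr \<alpha>"
        using C ge_one_powr_ge_zero[of C "\<bar>\<alpha>\<bar>"] by (simp add: mult_le_cancel_right1)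
      finally show ?thesis
        using D(1) by (simp add: powr_mult powr_minus field_simps)
    qed
  qed simp
  define c where "c = C powr \<bar>\<alpha>\<bar> * a powr - \<alpha>"
  have c: "0 \<le> c" by (simp add: c_def)
  define g where "g x = ennreal c * (f x * ennreal (heis_norm x powr \<alpha>) * indicator {x. heis_norm x < a * r} x)" for x
  have g [measurable]: "g \<in> borel_measurable borel"
    unfolding g_def by measurable
  have "(\<integral>\<^sup>+x\<in>{x. heis_norm x < r}. f (M *v x) * ennreal (heis_norm x powr \<alpha>) \<partial>lborel) \<le> (\<integral>\<^sup>+x. g (M *v x) \<partial>lborel)"
  proof (intro nn_integral_mono)
    fix x :: "'n heis"
    have "heis_norm (M *v x) < a * r" if "heis_norm x < r"
      using D(1) D(2)[of x] that by (smt (verit) mult_strict_left_mono)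
    moreover have "ennreal (heis_norm x powr \<alpha>) \<le> ennreal c * ennreal (heis_norm (M *v x) powr \<alpha>)"
      using wt[of x] c by (subst ennreal_mult'[symmetric]) (auto simp: c_def intro!: ennreal_leI)
    then have "f (M *v x) * ennreal (heis_norm x powr \<alpha>)
        \<le> f (M *v x) * (ennreal c * ennreal (heis_norm (M *v x) powr \<alpha>))"
      by (intro mult_left_mono) auto
    ultimately show "f (M *v x) * ennreal (heis_norm x powr \<alpha>) * indicator {x. heis_norm x < r} x \<le> g (M *v x)"
      by (auto simp: g_def indicator_def mult_ac)
  qed
  also have "\<dots> \<le> ennreal ((C / a) powr hdim TYPE('n)) * (\<integral>\<^sup>+x. g x \<partial>lborel)"
    by (rule nn_integral_quasi_dilation[OF M g])
  also have "(\<integral>\<^sup>+x. g x \<partial>lborel) = ennreal c * (\<integral>\<^sup>+x\<in>{x. heis_norm x < a * r}. f x * ennreal (heis_norm x powr \<alpha>) \<partial>lborel)"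
    unfolding g_def by (rule nn_integral_cmult) measurable
  also have "ennreal ((C / a) powr hdim TYPE('n)) * (ennreal c * (\<integral>\<^sup>+x\<in>{x. heis_norm x < a * r}. f x * ennreal (heis_norm x powr \<alpha>) \<partial>lborel))
      = ennreal ((C / a) powr hdim TYPE('n) * c) * (\<integral>\<^sup>+x\<in>{x. heis_norm x < a * r}. f x * ennreal (heis_norm x powr \<alpha>) \<partial>lborel)"
    using c by (simp add: ennreal_mult mult.assoc)
  also have "(C / a) powr hdim TYPE('n) * c = C powr (hdim TYPE('n) + \<bar>\<alpha>\<bar>) * a powr - (hdim TYPE('n) + \<alpha>)"
    using C D(1) by (simp add: c_def powr_divide powr_add powr_minus powr_diff field_simps)
  finally show ?thesis .
qed

lemma heis_norm_le_matnorm: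
  assumes "heis_matnorm M \<noteq> \<infinity>"
  shows "heis_norm (M *v x) \<le> enn2real (heis_matnorm M) * heis_norm x"
proof (cases "x = 0")
  case False
  have "ennreal (heis_norm (M *v x) / heis_norm x) \<le> heis_matnorm M"
    unfolding heis_matnorm_def using False by (intro SUP_upper) auto
  also have "\<dots> = ennreal (enn2real (heis_matnorm M))"
    using assms by (simp add: less_top)
  finally have "heis_norm (M *v x) / heis_norm x \<le> enn2real (heis_matnorm M)"
    by simp
  then show ?thesis
    using False by (simp add: field_simps)
qed simp

lemma heis_matnorm_pos:
  fixes M :: "'n::finite heis_mat"
  assumes "invertible M"
  shows "0 < heis_matnorm M"
proof -
  obtain x :: "'n heis" where x: "heis_norm x = 1"
    using exists_heis_norm_eq[of 1] by auto
  have x0: "x \<noteq> 0"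
  proof
    assume "x = 0"
    then show False using x by simp
  qed
  then have "M *v x \<noteq> 0"
    using assms by (metis invertible_def matrix_vector_mul_assoc matrix_vector_mul_lid matrix_vector_mult_0_right)
  then have "0 < ennreal (heis_norm (M *v x) / heis_norm x)"
    using x by simp
  also have "\<dots> \<le> heis_matnorm M"
    unfolding heis_matnorm_def using x0 by (intro SUP_upper) auto
  finally show ?thesis .
qed

text \<open>
  If \<open>\<parallel>M\<parallel>\<close> were infinite, the hypothesis would force \<open>\<parallel>M\<^sup>-\<^sup>1\<parallel> = 0\<close>, impossible for an invertible
  matrix. The lower bound on \<open>N(M x)\<close> is the norm bound for \<open>M\<^sup>-\<^sup>1\<close> at the point \<open>M x\<close>.
\<close>
lemma quasi_dilation_matnorm:
  fixes M :: "'n::finite heis_mat"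
  assumes det: "det M \<noteq> 0"
    and inv: "heis_matnorm (matrix_inv M) \<le> ennreal C * inverse (heis_matnorm M)"
  shows "heis_matnorm M \<noteq> \<infinity>" "quasi_dilation C (enn2real (heis_matnorm M)) M"
proof -
  have M: "invertible M"
    using det by (simp add: invertible_det_nz)
  have left: "matrix_inv M ** M = mat 1" and right: "M ** matrix_inv M = mat 1"
    using M by (auto simp: invertible_def matrix_inv_def some_eq_ex intro: someI2_ex)
  have Mi: "invertible (matrix_inv M)"
    using left right by (auto simp: invertible_def)
  have pos: "0 < heis_matnorm M" "0 < heis_matnorm (matrix_inv M)"
    using M Mi by (auto intro: heis_matnorm_pos)
  show fin: "heis_matnorm M \<noteq> \<infinity>"
  proof
    assume "heis_matnorm M = \<infinity>"
    then have "heis_matnorm (matrix_inv M) \<le> 0"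
      using inv by simp
    then show False using pos by simp
  qed
  define a where "a = enn2real (heis_matnorm M)"
  have a: "0 < a" "heis_matnorm M = ennreal a"
    using pos fin by (auto simp: a_def enn2real_positive_iff less_top)
  have "ennreal C * inverse (heis_matnorm M) = ennreal (max C 0 / a)"
  proof (cases "0 \<le> C")
    case True
    then show ?thesis
      using a by (simp add: inverse_ennreal divide_inverse ennreal_mult')
  qed (simp add: ennreal_neg)
  then have inv': "heis_matnorm (matrix_inv M) \<le> ennreal (max C 0 / a)"
    using inv by simp
  then have fin': "heis_matnorm (matrix_inv M) \<noteq> \<infinity>"
    by (auto simp: top_unique)
  have le: "enn2real (heis_matnorm (matrix_inv M)) \<le> max C 0 / a"
    using inv' a by (intro enn2real_leI) auto
  have "0 < ennreal (max C 0 / a)"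
    using pos(2) inv' by (rule less_le_trans)
  then have C: "0 < C" using a by (auto simp: max_def zero_less_divide_iff split: if_splits)
  show "quasi_dilation C (enn2real (heis_matnorm M)) M"
    unfolding quasi_dilation_def a_def[symmetric]
  proof (intro conjI allI a)
    fix x
    show "heis_norm (M *v x) \<le> a * heis_norm x"
      unfolding a_def by (rule heis_norm_le_matnorm[OF fin])
    have "heis_norm x = heis_norm (matrix_inv M *v (M *v x))"
      by (simp add: matrix_vector_mul_assoc left)
    also have "\<dots> \<le> enn2real (heis_matnorm (matrix_inv M)) * heis_norm (M *v x)"
      by (rule heis_norm_le_matnorm[OF fin'])
    also have "\<dots> \<le> C / a * heis_norm (M *v x)"
      using le C by (intro mult_right_mono) auto
    finally show "a * heis_norm x \<le> C * heis_norm (M *v x)"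
      using a by (simp add: field_simps)
  qed
qed

text \<open>A supremum over uncountably many points, but of continuous functions of the matrix, hence
  lower semicontinuous.\<close>
lemma borel_measurable_heis_matnorm [measurable]:
  "heis_matnorm \<in> borel_measurable (borel :: 'n::finite heis_mat measure)"
proof (rule borel_measurableI_greater)
  fix c :: ennreal
  have "{M \<in> space borel. c < heis_matnorm M} = (\<Union>x\<in>{x. x \<noteq> 0}. {M::'n heis_mat. c < ennreal (heis_norm (M *v x) / heis_norm x)})"
    by (auto simp: heis_matnorm_def less_SUP_iff)
  moreover have "open {M::'n heis_mat. c < ennreal (heis_norm (M *v x) / heis_norm x)}" if "x \<noteq> 0" for x
    using that by (intro open_Collect_less continuous_on_ennreal continuous_intros) (auto simp: matrix_vector_mult_def intro!: continuous_intros)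
  ultimately show "{M \<in> space borel. c < heis_matnorm (M::'n heis_mat)} \<in> sets borel"
    by (auto intro!: borel_open)
qed

section \<open>Jensen's inequality for powers\<close>

lemma powr_above_tangent:
  fixes p t x :: real
  assumes p: "1 \<le> p" and t: "0 < t" and x: "0 \<le> x"
  shows "t powr p + p * t powr (p - 1) * (x - t) \<le> x powr p"
proof (cases "x = 0")
  case True
  have "t powr p = t powr (p - 1) * t"
    using t by (simp add: powr_diff)
  then have "t powr p + p * t powr (p - 1) * (x - t) = (1 - p) * (t powr (p - 1) * t)"
    using True by (simp add: algebra_simps)
  also have "\<dots> \<le> 0"
    using p t by (intro mult_nonpos_nonneg) auto
  finally show ?thesis using True by simp
next
  case False
  have "convex_on {0<..} (\<lambda>x. x powr p)" by (rule powr_convex[OF p])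
  moreover have "((\<lambda>x. x powr p) has_real_derivative p * t powr (p - 1)) (at t within {0<..})"
    using t by (auto intro!: derivative_eq_intros)
  ultimately have "p * t powr (p - 1) * (x - t) \<le> x powr p - t powr p"
    using False x t by (intro convex_on_imp_above_tangent[where A="{0<..}"]) (auto simp: interior_open)
  then show ?thesis by simp
qed

text \<open>
  Jensen's inequality for the finite measure with density \<open>u\<close>, of total mass \<open>T\<close>. It is proved by
  integrating the tangent line of \<open>x\<^sup>p\<close> at the mean \<open>t = T\<^sup>-\<^sup>1 \<integral> u h\<close>. That \<open>u h\<close> is integrable is
  part of the conclusion, because in the application this is the existence of the integral defining
  the operator.
\<close>
lemma weighted_jensen_powr:
  fixes u h :: "'a \<Rightarrow> real"
  assumes p: "1 \<le> p"
    and [measurable]: "u \<in> borel_measurable M" "h \<in> borel_measurable M"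
    and u: "\<And>y. 0 \<le> u y" and h: "\<And>y. 0 \<le> h y"
    and T: "(\<integral>\<^sup>+y. ennreal (u y) \<partial>M) = ennreal T" "0 \<le> T"
    and D: "(\<integral>\<^sup>+y. ennreal (u y * h y powr p) \<partial>M) < \<infinity>"
  shows "integrable M (\<lambda>y. u y * h y)"
    and "ennreal ((\<integral>y. u y * h y \<partial>M) powr p) \<le> ennreal (T powr (p - 1)) * (\<integral>\<^sup>+y. ennreal (u y * h y powr p) \<partial>M)"
proof -
  have iu: "integrable M u"
    using T u by (intro integrableI_nonneg) auto
  have eT: "(\<integral>y. u y \<partial>M) = T"
    using T u by (simp add: integral_eq_nn_integral)
  have ip: "integrable M (\<lambda>y. u y * h y powr p)"
    using D u by (intro integrableI_nonneg) auto
  \<comment> \<open>On a finite measure space the \<open>p\<close>-th power controls the function itself.\<close>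
  have "h y \<le> 1 + h y powr p" for y
  proof (cases "h y \<le> 1")
    case False
    then have "h y powr 1 \<le> h y powr p" using p by (intro powr_mono) auto
    then show ?thesis using False by simp
  qed (smt (verit) powr_ge_zero)
  then have "u y * h y \<le> u y + u y * h y powr p" for y
    using u[of y] mult_left_mono[of "h y" "1 + h y powr p" "u y"] by (simp add: algebra_simps)
  then show ih: "integrable M (\<lambda>y. u y * h y)"
    using u h by (intro Bochner_Integration.integrable_bound[OF Bochner_Integration.integrable_add[OF iu ip]]) auto
  define I where "I = (\<integral>y. u y * h y \<partial>M)"
  have "0 \<le> I" unfolding I_def using u h by (intro integral_nonneg_AE) auto
  have "I powr p \<le> T powr (p - 1) * (\<integral>y. u y * h y powr p \<partial>M)"
  proof (cases "I = 0")
    case True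
    then show ?thesis using u by (auto intro!: mult_nonneg_nonneg integral_nonneg_AE)
  next
    case False
    then have I: "0 < I" using \<open>0 \<le> I\<close> by simp
    have "T \<noteq> 0"
    proof
      assume "T = 0"
      then have "AE y in M. u y = 0"
        using integral_nonneg_eq_0_iff_AE[OF iu] u eT by auto
      then have "I = 0" unfolding I_def by (intro integral_eq_zero_AE) auto
      then show False using I by simp
    qed
    then have T0: "0 < T" using T by simp
    define t where "t = I / T"
    have t: "0 < t" using I T0 by (simp add: t_def)
    have "T * t powr p = (\<integral>y. (t powr p - p * t powr (p - 1) * t) * u y + p * t powr (p - 1) * (u y * h y) \<partial>M)"
      using iu ih T0 by (simp add: eT I_def[symmetric] t_def) (simp add: field_simps)
    also have "\<dots> \<le> (\<integral>y. u y * h y powr p \<partial>M)"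
    proof (intro integral_mono)
      fix y
      show "(t powr p - p * t powr (p - 1) * t) * u y + p * t powr (p - 1) * (u y * h y) \<le> u y * h y powr p"
        using mult_left_mono[OF powr_above_tangent[OF p t h] u, of y y] by (simp add: algebra_simps)
    qed (use iu ih ip in auto)
    finally have "T * t powr p \<le> (\<integral>y. u y * h y powr p \<partial>M)" .
    then have "T powr (p - 1) * (T * t powr p) \<le> T powr (p - 1) * (\<integral>y. u y * h y powr p \<partial>M)"
      by (intro mult_left_mono) auto
    moreover have "T powr (p - 1) * (T * t powr p) = I powr p"
      using T0 I by (simp add: t_def powr_divide powr_diff)
    ultimately show ?thesis by simp
  qed
  then have "ennreal (I powr p) \<le> ennreal (T powr (p - 1) * (\<integral>y. u y * h y powr p \<partial>M))"
    by (rule ennreal_leI)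
  also have "\<dots> = ennreal (T powr (p - 1)) * (\<integral>\<^sup>+y. ennreal (u y * h y powr p) \<partial>M)"
    by (subst nn_integral_eq_integral[OF ip]) (use u in \<open>auto simp: ennreal_mult'\<close>)
  finally show "ennreal ((\<integral>y. u y * h y \<partial>M) powr p) \<le> ennreal (T powr (p - 1)) * (\<integral>\<^sup>+y. ennreal (u y * h y powr p) \<partial>M)"
    unfolding I_def .
qed

section \<open>Lebesgue measurable functions\<close>

text \<open>
  Compositions such as \<open>f(A(y) x)\<close> of Lebesgue measurable functions need not be measurable on the product space.
  Passing to Borel representatives of \<open>f\<close>, \<open>A\<close> and \<open>\<Phi>\<close> makes Tonelli's theorem applicable.
\<close>
lemma lebesgue_borel_representative:
  fixes f :: "'a::euclidean_space \<Rightarrow> 'b::euclidean_space"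
  assumes "f \<in> borel_measurable lebesgue"
  obtains g where "g \<in> borel_measurable borel" "AE x in lborel. f x = g x"
proof -
  have "\<exists>g. g \<in> borel_measurable borel \<and> (AE x in lborel. f x \<bullet> b = g x)" for b
  proof -
    have "(\<lambda>x. f x \<bullet> b) \<in> borel_measurable (completion lborel)"
      using assms by simp
    from completion_ex_borel_measurable_real[OF this] show ?thesis by auto
  qed
  then obtain g where g: "\<And>b. g b \<in> borel_measurable borel" "\<And>b. AE x in lborel. f x \<bullet> b = g b x"
    by metis
  show thesis
  proof
    show "(\<lambda>x. \<Sum>b\<in>Basis. g b x *\<^sub>R b) \<in> borel_measurable borel"
      using g(1) by measurable
    have "AE x in lborel. \<forall>b\<in>Basis. f x \<bullet> b = g b x"
      using g(2) by (simp add: AE_ball_countable countable_finite)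
    then show "AE x in lborel. f x = (\<Sum>b\<in>Basis. g b x *\<^sub>R b)"
    proof eventually_elim
      case (elim x)
      have "f x = (\<Sum>b\<in>Basis. (f x \<bullet> b) *\<^sub>R b)" by (simp add: euclidean_representation)
      also have "\<dots> = (\<Sum>b\<in>Basis. g b x *\<^sub>R b)" using elim by simp
      finally show ?case .
    qed
  qed
qed

lemma locally_integrable_measurable:
  fixes f :: "'a::euclidean_space \<Rightarrow> real"
  assumes "locally_integrable f"
  shows "f \<in> borel_measurable lebesgue"
proof (rule borel_measurable_LIMSEQ_real)
  show "(\<lambda>x. indicat_real (cball 0 (real n)) x *\<^sub>R f x) \<in> borel_measurable lebesgue" for n
    using assms unfolding locally_integrable_def set_integrable_def
    by (intro borel_measurable_integrable) auto
  show "(\<lambda>n. indicat_real (cball 0 (real n)) x *\<^sub>R f x) \<longlonglongrightarrow> f x" for x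
  proof (rule tendsto_eventually)
    obtain N where "norm x \<le> real N" using real_arch_simple by blast
    then show "\<forall>\<^sub>F n in sequentially. indicat_real (cball 0 (real n)) x *\<^sub>R f x = f x"
      by (intro eventually_sequentiallyI[of N]) (auto simp: indicator_def)
  qed
qed

section \<open>The Morrey norm as a growth condition\<close>

lemma ennreal_powr_ennreal: "0 < x \<Longrightarrow> ennreal_powr (ennreal x) a = ennreal (x powr a)"
  by (auto simp: ennreal_powr_def)

lemma ennreal_powr_inverse_exponent_le_iff:
  assumes p: "0 < p" and v: "0 < v" and K: "0 \<le> K"
  shows "ennreal_powr (1 / ennreal v * I) (1 / p) \<le> ennreal K \<longleftrightarrow> I \<le> ennreal (K powr p * v)"
proof (cases I)
  case top
  have "1 / ennreal v * I = top"
    using v top by (simp add: divide_ennreal_def inverse_ennreal ennreal_mult_eq_top_iff ennreal_eq_0_iff)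
  then show ?thesis
    using p top by (simp add: ennreal_powr_def top_unique)
next
  case (real i)
  have i: "1 / ennreal v * I = ennreal (i / v)"
    using v real by (simp add: divide_ennreal_def inverse_ennreal ennreal_mult[symmetric] divide_inverse mult.commute)
  show ?thesis
  proof (cases "i = 0")
    case True
    then show ?thesis using i p real by (simp add: ennreal_powr_def)
  next
    case False
    then have iv: "0 < i / v" using real v by simp
    have "ennreal_powr (1 / ennreal v * I) (1 / p) \<le> ennreal K \<longleftrightarrow> (i / v) powr (1 / p) \<le> K"
      unfolding i using iv K by (simp add: ennreal_powr_ennreal)
    also have "\<dots> \<longleftrightarrow> i / v \<le> K powr p"
    proof
      assume "(i / v) powr (1 / p) \<le> K"
      then have "((i / v) powr (1 / p)) powr p \<le> K powr p"
        using p by (intro powr_mono2) auto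
      then show "i / v \<le> K powr p" using p iv v real by (simp add: powr_powr)
    next
      assume "i / v \<le> K powr p"
      then have "(i / v) powr (1 / p) \<le> (K powr p) powr (1 / p)"
        using p iv by (intro powr_mono2) auto
      then show "(i / v) powr (1 / p) \<le> K" using p K by (simp add: powr_powr)
    qed
    also have "\<dots> \<longleftrightarrow> I \<le> ennreal (K powr p * v)"
      using v real by (simp add: field_simps)
    finally show ?thesis .
  qed
qed

text \<open>
  The constant \<open>W\<close> is the weight of the unit ball; by homogeneity the ball of radius \<open>r\<close> has weight
  \<open>W r\<^sup>\<gamma>\<close>. The parameter \<open>dim_type\<close> carries the type that encodes the dimension.
\<close>
locale heis_morrey =
  fixes dim_type :: "'n::finite itself" and p l \<alpha> W :: real
  assumes p: "1 \<le> p" and lp: "0 \<le> 1 + p * l" and l: "l < 0"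
    and \<alpha>: "- hdim TYPE('n) < \<alpha>" and W: "0 < W"
    and weight_ball: "\<And>r. 0 < r \<Longrightarrow>
      (\<integral>\<^sup>+x\<in>{x::'n heis. heis_norm x < r}. ennreal (heis_norm x powr \<alpha>) \<partial>lborel)
        = ennreal (W * r powr (hdim TYPE('n) + \<alpha>))"
begin

definition \<gamma> :: real where "\<gamma> = hdim TYPE('n) + \<alpha>"

definition V :: "real \<Rightarrow> real" where "V r = W * r powr \<gamma>"

definition growth :: "real \<Rightarrow> real" where "growth r = V r powr (1 + p * l)"

definition energy :: "('n heis \<Rightarrow> complex) \<Rightarrow> real \<Rightarrow> ennreal" where
  "energy f r = (\<integral>\<^sup>+x\<in>{x. heis_norm x < r}. ennreal (cmod (f x) powr p * heis_norm x powr \<alpha>) \<partial>lborel)"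

abbreviation mnorm :: "('n heis \<Rightarrow> complex) \<Rightarrow> ennreal" where
  "mnorm \<equiv> morrey_norm p l (\<lambda>x. heis_norm x powr \<alpha>)"

abbreviation mspace :: "('n heis \<Rightarrow> complex) set" where
  "mspace \<equiv> morrey_space p l (\<lambda>x. heis_norm x powr \<alpha>)"

lemma \<gamma>_pos: "0 < \<gamma>"
  using \<alpha> by (simp add: \<gamma>_def)

lemma V_pos: "0 < r \<Longrightarrow> 0 < V r"
  using W by (simp add: V_def)

lemma growth_pos: "0 < r \<Longrightarrow> 0 < growth r"
  using V_pos[of r] by (simp add: growth_def)

lemma growth_scale: "0 < a \<Longrightarrow> 0 < r \<Longrightarrow> growth (a * r) = a powr (\<gamma> * (1 + p * l)) * growth r"
  using W by (simp add: growth_def V_def powr_mult powr_powr)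

text \<open>
  All later estimates of Morrey norms go through this reformulation as a bound on the integrals over
  balls, which avoids computing with extended real powers and suprema.
\<close>
lemma mnorm_le_iff:
  assumes K: "0 \<le> K"
  shows "mnorm f \<le> ennreal K \<longleftrightarrow> (\<forall>r>0. energy f r \<le> ennreal (K powr p * growth r))"
proof -
  have eq: "ennreal_powr (1 / ennreal_powr (weight_of (\<lambda>x::'n heis. heis_norm x powr \<alpha>) (heis_ball 0 r)) (1 + p * l)
         * (\<integral>\<^sup>+x\<in>heis_ball 0 r. ennreal (cmod (f x) powr p * heis_norm x powr \<alpha>) \<partial>lebesgue)) (1 / p)
      \<le> ennreal K \<longleftrightarrow> energy f r \<le> ennreal (K powr p * growth r)" if r: "0 < r" for r
  proof -
    have "weight_of (\<lambda>x::'n heis. heis_norm x powr \<alpha>) (heis_ball 0 r) = ennreal (V r)"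
      unfolding weight_of_def heis_ball_0 nn_integral_completion V_def \<gamma>_def by (rule weight_ball[OF r])
    then have "ennreal_powr (weight_of (\<lambda>x::'n heis. heis_norm x powr \<alpha>) (heis_ball 0 r)) (1 + p * l) = ennreal (growth r)"
      using V_pos[OF r] by (simp add: ennreal_powr_ennreal growth_def)
    moreover have "(\<integral>\<^sup>+x\<in>heis_ball 0 r. ennreal (cmod (f x) powr p * heis_norm x powr \<alpha>) \<partial>lebesgue) = energy f r"
      unfolding energy_def heis_ball_0 nn_integral_completion ..
    ultimately show ?thesis
      using p growth_pos[OF r] K by (simp add: ennreal_powr_inverse_exponent_le_iff)
  qed
  show ?thesis
    unfolding morrey_norm_def SUP_le_iff using eq by (auto simp del: nn_integral_completion)
qed

lemma mspaceI:
  assumes f: "f \<in> borel_measurable lebesgue" and le: "mnorm f \<le> ennreal K" and K: "0 \<le> K"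
  shows "f \<in> mspace"
proof -
  have "(\<integral>\<^sup>+x\<in>S. ennreal (cmod (f x) powr p * heis_norm x powr \<alpha>) \<partial>lebesgue) < \<infinity>" if S: "compact S" for S
  proof -
    obtain r where r: "0 < r" "S \<subseteq> heis_ball 0 r"
      using heis_norm_bounded_on_compact[OF S] .
    have "(\<integral>\<^sup>+x\<in>S. ennreal (cmod (f x) powr p * heis_norm x powr \<alpha>) \<partial>lebesgue) \<le> energy f r"
      unfolding energy_def nn_integral_completion
      by (intro nn_integral_mono) (use r in \<open>auto simp: indicator_def heis_ball_0\<close>)
    also have "\<dots> \<le> ennreal (K powr p * growth r)"
      using le r unfolding mnorm_le_iff[OF K] by blast
    also have "\<dots> < \<infinity>" by simp
    finally show ?thesis .
  qed
  moreover have "mnorm f < \<infinity>"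
    using le_less_trans[OF le, of \<infinity>] by simp
  ultimately show ?thesis
    using f by (simp add: morrey_space_def Lp_loc_def)
qed

lemma mspaceE:
  assumes "f \<in> mspace"
  obtains K where "0 \<le> K" "mnorm f = ennreal K" "f \<in> borel_measurable lebesgue"
  using assms that[of "enn2real (mnorm f)"] by (auto simp: morrey_space_def Lp_loc_def)

lemma energy_cong_AE: "AE x in lborel. cmod (f x) = cmod (g x) \<Longrightarrow> energy f r = energy g r"
  unfolding energy_def by (intro nn_integral_cong_AE) auto

section \<open>Finiteness of the integral implies boundedness\<close>

text \<open>
  Composition with \<open>M\<close> multiplies the Morrey norm by at most a constant times \<open>a\<^sup>\<gamma>\<^sup>l\<close>: the change of
  variables contributes \<open>a\<^sup>-\<^sup>\<gamma>\<close>, and the growth of the ball of radius \<open>a r\<close> contributes \<open>a\<^sup>\<gamma>\<^sup>(\<^sup>1\<^sup>+\<^sup>p\<^sup>l\<^sup>)\<close>.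
\<close>
lemma energy_quasi_dilation:
  assumes M: "quasi_dilation C a M" and f [measurable]: "f \<in> borel_measurable borel"
    and K: "\<And>r. 0 < r \<Longrightarrow> energy f r \<le> ennreal (K powr p * growth r)" and r: "0 < r"
  shows "energy (\<lambda>x. f (M *v x)) r
    \<le> ennreal (C powr (hdim TYPE('n) + \<bar>\<alpha>\<bar>) * K powr p * growth r * a powr (\<gamma> * l * p))"
proof -
  note D = quasi_dilationD[OF M]
  have C: "1 \<le> C" by (rule quasi_dilation_const_ge_1[OF M])
  define c where "c = C powr (hdim TYPE('n) + \<bar>\<alpha>\<bar>) * a powr - \<gamma>"
  have en: "energy g r = (\<integral>\<^sup>+x\<in>{x. heis_norm x < r}. ennreal (cmod (g x) powr p) * ennreal (heis_norm x powr \<alpha>) \<partial>lborel)" for g r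
    unfolding energy_def by (simp add: ennreal_mult)
  have "energy (\<lambda>x. f (M *v x)) r \<le> ennreal c * energy f (a * r)"
    unfolding en c_def \<gamma>_def
    by (rule weighted_nn_integral_quasi_dilation[OF M, where f="\<lambda>x. ennreal (cmod (f x) powr p)"]) measurable
  also have "\<dots> \<le> ennreal c * ennreal (K powr p * growth (a * r))"
    by (intro mult_left_mono K) (use D(1) r in auto)
  also have "\<dots> = ennreal (c * (K powr p * growth (a * r)))"
    using growth_pos[of "a * r"] D(1) r by (simp add: ennreal_mult'[symmetric] c_def)
  also have "c * (K powr p * growth (a * r)) = C powr (hdim TYPE('n) + \<bar>\<alpha>\<bar>) * K powr p * growth r * (a powr - \<gamma> * a powr (\<gamma> * (1 + p * l)))"
    using D(1) r by (simp add: c_def growth_scale)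
  also have "a powr - \<gamma> * a powr (\<gamma> * (1 + p * l)) = a powr (\<gamma> * l * p)"
    by (simp add: powr_add[symmetric] algebra_simps)
  finally show ?thesis .
qed

lemma measurable_matrix_vector_mult [measurable (raw)]:
  fixes B :: "'b \<Rightarrow> 'n heis_mat"
  assumes "B \<in> borel_measurable S" "g \<in> borel_measurable S"
  shows "(\<lambda>y. B y *v g y) \<in> borel_measurable S"
proof -
  have "continuous_on UNIV (\<lambda>z. fst z *v (snd z :: 'n heis) :: 'n heis)"
    unfolding matrix_vector_mult_def by (intro continuous_intros)
  from borel_measurable_continuous_Pair[OF assms this] show ?thesis by simp
qed

text \<open>
  This is Minkowski's integral inequality for the functions \<open>f(B(y) \<cdot>)\<close>. Since their norms are at most
  a constant times \<open>b(y)\<^sup>\<gamma>\<^sup>l\<close> with \<open>b\<close> known in advance, Jensen's inequality for the weight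
  \<open>u = \<phi> b\<^sup>\<gamma>\<^sup>l\<close> and the function \<open>h = |f(B(y) x)| b(y)\<^sup>-\<^sup>\<gamma>\<^sup>l\<close> gives, at almost every \<open>x\<close>,
  \<open>|\<integral> \<phi> f(B(y) x) dy|\<^sup>p \<le> T\<^sup>p\<^sup>-\<^sup>1 D(x)\<close> with \<open>D(x) = \<integral> u h\<^sup>p dy\<close>, and the weighted integral of \<open>D\<close> over a ball
  is computed by exchanging the order of integration. Finiteness of the latter also gives
  \<open>D(x) < \<infinity>\<close> almost everywhere, as Jensen's inequality requires.
\<close>
lemma hausdorff_average_bound:
  fixes \<phi> :: "'n heis \<Rightarrow> real" and B :: "'n heis \<Rightarrow> 'n heis_mat" and f :: "'n heis \<Rightarrow> complex"
  assumes \<phi> [measurable]: "\<phi> \<in> borel_measurable borel" and \<phi>0: "\<And>y. 0 \<le> \<phi> y"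
    and B [measurable]: "B \<in> borel_measurable borel" and b [measurable]: "b \<in> borel_measurable borel"
    and qd: "AE y in lborel. \<phi> y \<noteq> 0 \<longrightarrow> quasi_dilation C (b y) (B y)"
    and T: "(\<integral>\<^sup>+y. ennreal (\<phi> y * b y powr (\<gamma> * l)) \<partial>lborel) = ennreal T" "0 \<le> T"
    and f [measurable]: "f \<in> borel_measurable borel"
    and K: "0 \<le> K" "\<And>r. 0 < r \<Longrightarrow> energy f r \<le> ennreal (K powr p * growth r)"
  shows "AE x in lborel. integrable lborel (\<lambda>y. of_real (\<phi> y) * f (B y *v x))"
    and "0 < r \<Longrightarrow> energy (\<lambda>x. \<integral>y. of_real (\<phi> y) * f (B y *v x) \<partial>lborel) r
       \<le> ennreal ((C powr ((hdim TYPE('n) + \<bar>\<alpha>\<bar>) / p) * T * K) powr p * growth r)"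
proof -
  define s where "s = \<gamma> * l"
  define u where "u y = \<phi> y * b y powr s" for y
  define h where "h x y = cmod (f (B y *v x)) / b y powr s" for x y
  define D where "D x = (\<integral>\<^sup>+y. ennreal (u y * h x y powr p) \<partial>lborel)" for x
  define c where "c = C powr (hdim TYPE('n) + \<bar>\<alpha>\<bar>)"
  have c: "0 \<le> c" by (simp add: c_def)
  have u0: "0 \<le> u y" and h0: "0 \<le> h x y" for x y
    using \<phi>0 by (auto simp: u_def h_def)
  have [measurable]: "u \<in> borel_measurable borel" unfolding u_def by measurable
  have h_pair [measurable]: "(\<lambda>(x, y). h x y) \<in> borel_measurable (lborel \<Otimes>\<^sub>M lborel)"
    unfolding h_def by measurable
  have [measurable]: "h x \<in> borel_measurable borel" for x
    unfolding h_def by measurable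
  have [measurable]: "D \<in> borel_measurable lborel"
    unfolding D_def by measurable
  have D_bound: "(\<integral>\<^sup>+x\<in>{x. heis_norm x < r}. D x * ennreal (heis_norm x powr \<alpha>) \<partial>lborel)
      \<le> ennreal (c * K powr p * growth r * T)" if r: "0 < r" for r
  proof -
    have "(\<integral>\<^sup>+x\<in>{x. heis_norm x < r}. D x * ennreal (heis_norm x powr \<alpha>) \<partial>lborel)
       = (\<integral>\<^sup>+x. (\<integral>\<^sup>+y. ennreal (u y * h x y powr p) * (ennreal (heis_norm x powr \<alpha>) * indicator {x. heis_norm x < r} x) \<partial>lborel) \<partial>lborel)"
      unfolding D_def by (intro nn_integral_cong) (simp add: nn_integral_multc mult.assoc)
    also have "\<dots> = (\<integral>\<^sup>+y. (\<integral>\<^sup>+x. ennreal (u y * h x y powr p) * (ennreal (heis_norm x powr \<alpha>) * indicator {x. heis_norm x < r} x) \<partial>lborel) \<partial>lborel)"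
      by (rule lborel_pair.Fubini') measurable
    also have "\<dots> \<le> (\<integral>\<^sup>+y. ennreal (c * K powr p * growth r) * ennreal (\<phi> y * b y powr s) \<partial>lborel)"
      using qd
    proof (intro nn_integral_mono_AE, eventually_elim)
      case (elim y)
      show ?case
      proof (cases "\<phi> y = 0")
        case False
        then have M: "quasi_dilation C (b y) (B y)" using elim by simp
        have b: "0 < b y" by (rule quasi_dilationD[OF M])
        have "(\<integral>\<^sup>+x. ennreal (u y * h x y powr p) * (ennreal (heis_norm x powr \<alpha>) * indicator {x. heis_norm x < r} x) \<partial>lborel)
          = (\<integral>\<^sup>+x. ennreal (u y * b y powr - (s * p)) * (ennreal (cmod (f (B y *v x)) powr p * heis_norm x powr \<alpha>) * indicator {x. heis_norm x < r} x) \<partial>lborel)"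
        proof (intro nn_integral_cong)
          fix x
          have scale: "u y * h x y powr p = u y * b y powr - (s * p) * cmod (f (B y *v x)) powr p"
            using b by (simp add: h_def powr_divide powr_powr powr_minus divide_simps)
          show "ennreal (u y * h x y powr p) * (ennreal (heis_norm x powr \<alpha>) * indicator {x. heis_norm x < r} x)
             = ennreal (u y * b y powr - (s * p)) * (ennreal (cmod (f (B y *v x)) powr p * heis_norm x powr \<alpha>) * indicator {x. heis_norm x < r} x)"
            unfolding scale using u0[of y] by (simp add: ennreal_mult mult.assoc)
        qed
        also have "\<dots> = ennreal (u y * b y powr - (s * p)) * energy (\<lambda>x. f (B y *v x)) r"
          unfolding energy_def by (rule nn_integral_cmult) measurable
        also have "\<dots> \<le> ennreal (u y * b y powr - (s * p)) * ennreal (c * K powr p * growth r * b y powr (s * p))"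
          unfolding c_def s_def by (intro mult_left_mono energy_quasi_dilation[OF M f K(2) r]) auto
        also have "\<dots> = ennreal ((u y * b y powr - (s * p)) * (c * K powr p * growth r * b y powr (s * p)))"
          using u0 by (intro ennreal_mult'[symmetric]) auto
        also have "(u y * b y powr - (s * p)) * (c * K powr p * growth r * b y powr (s * p)) = c * K powr p * growth r * (\<phi> y * b y powr s)"
          using b by (simp add: u_def powr_minus field_simps)
        also have "ennreal \<dots> = ennreal (c * K powr p * growth r) * ennreal (\<phi> y * b y powr s)"
          using c growth_pos[OF r] by (intro ennreal_mult') auto
        finally show ?thesis .
      qed (simp add: u_def)
    qed
    also have "\<dots> = ennreal (c * K powr p * growth r) * ennreal T"
      by (simp add: nn_integral_cmult T s_def)
    also have "\<dots> = ennreal (c * K powr p * growth r * T)"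
      using c growth_pos[OF r] by (intro ennreal_mult'[symmetric]) auto
    finally show ?thesis .
  qed
  have D_fin: "AE x in lborel. D x < \<infinity>"
  proof -
    have "AE x in lborel. D x * ennreal (heis_norm x powr \<alpha>) * indicator {x. heis_norm x < real (Suc n)} x \<noteq> \<infinity>" for n
      using D_bound[of "real (Suc n)"] by (intro nn_integral_PInf_AE) (auto simp: top_unique)
    then have "AE x in lborel. \<forall>n. D x * ennreal (heis_norm x powr \<alpha>) * indicator {x. heis_norm x < real (Suc n)} x \<noteq> \<infinity>"
      by (simp add: AE_all_countable)
    moreover have "AE x in lborel. x \<noteq> (0::'n heis)"
      by (rule AE_lborel_singleton)
    ultimately show ?thesis
    proof eventually_elim
      case (elim x)
      obtain n where "heis_norm x < real n" using reals_Archimedean2 by blast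
      then have "heis_norm x < real (Suc n)" by simp
      then have "D x * ennreal (heis_norm x powr \<alpha>) \<noteq> \<infinity>"
        using elim(1)[rule_format, of n] by simp
      then show ?case
        using elim(2) by (auto simp: ennreal_mult_eq_top_iff less_top)
    qed
  qed
  have uh: "AE y in lborel. \<forall>x. u y * h x y = cmod (of_real (\<phi> y) * f (B y *v x))"
    using qd
  proof eventually_elim
    case (elim y)
    then show ?case
      using \<phi>0[of y] quasi_dilationD(1)[of C "b y" "B y"]
      by (cases "\<phi> y = 0") (auto simp: u_def h_def norm_mult)
  qed
  have T': "(\<integral>\<^sup>+y. ennreal (u y) \<partial>lborel) = ennreal T"
    using T by (simp add: u_def s_def)
  have pointwise: "AE x in lborel. integrable lborel (\<lambda>y. of_real (\<phi> y) * f (B y *v x)) \<and>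
      ennreal (cmod (\<integral>y. of_real (\<phi> y) * f (B y *v x) \<partial>lborel) powr p) \<le> ennreal (T powr (p - 1)) * D x"
    using D_fin
  proof eventually_elim
    case (elim x)
    note J = weighted_jensen_powr[OF p _ _ u0 h0 T' T(2) elim[unfolded D_def]]
    have uh': "AE y in lborel. u y * h x y = cmod (of_real (\<phi> y) * f (B y *v x))"
      using uh by eventually_elim blast
    have i1: "integrable lborel (\<lambda>y. u y * h x y)"
      by (rule J) measurable
    have "integrable lborel (\<lambda>y. cmod (of_real (\<phi> y) * f (B y *v x)))"
      by (rule integrable_cong_AE_imp[OF i1]) (use uh' in \<open>auto simp: eq_commute\<close>)
    then have int: "integrable lborel (\<lambda>y. of_real (\<phi> y) * f (B y *v x))"
      by (subst (asm) integrable_norm_iff) auto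
    have "cmod (\<integral>y. of_real (\<phi> y) * f (B y *v x) \<partial>lborel) \<le> (\<integral>y. cmod (of_real (\<phi> y) * f (B y *v x)) \<partial>lborel)"
      by (rule integral_norm_bound)
    also have "\<dots> = (\<integral>y. u y * h x y \<partial>lborel)"
      by (rule integral_cong_AE) (use uh' in \<open>auto simp: eq_commute\<close>)
    finally have "ennreal (cmod (\<integral>y. of_real (\<phi> y) * f (B y *v x) \<partial>lborel) powr p) \<le> ennreal ((\<integral>y. u y * h x y \<partial>lborel) powr p)"
      using p by (intro ennreal_leI powr_mono2) auto
    also have "\<dots> \<le> ennreal (T powr (p - 1)) * D x"
      unfolding D_def by (rule J) measurable
    finally show ?case using int by blast
  qed
  then show "AE x in lborel. integrable lborel (\<lambda>y. of_real (\<phi> y) * f (B y *v x))"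
    by eventually_elim blast
  assume r: "0 < r"
  have "energy (\<lambda>x. \<integral>y. of_real (\<phi> y) * f (B y *v x) \<partial>lborel) r
     \<le> (\<integral>\<^sup>+x. ennreal (T powr (p - 1)) * (D x * ennreal (heis_norm x powr \<alpha>) * indicator {x. heis_norm x < r} x) \<partial>lborel)"
    unfolding energy_def using pointwise
  proof (intro nn_integral_mono_AE, eventually_elim)
    case (elim x)
    have "ennreal (cmod (\<integral>y. of_real (\<phi> y) * f (B y *v x) \<partial>lborel) powr p) * ennreal (heis_norm x powr \<alpha>)
        \<le> ennreal (T powr (p - 1)) * D x * ennreal (heis_norm x powr \<alpha>)"
      using elim by (intro mult_right_mono) auto
    then show ?case
      by (auto simp: indicator_def ennreal_mult mult.assoc)
  qed
  also have "\<dots> = ennreal (T powr (p - 1)) * (\<integral>\<^sup>+x\<in>{x. heis_norm x < r}. D x * ennreal (heis_norm x powr \<alpha>) \<partial>lborel)"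
    by (rule nn_integral_cmult) measurable
  also have "\<dots> \<le> ennreal (T powr (p - 1)) * ennreal (c * K powr p * growth r * T)"
    by (intro mult_left_mono D_bound r) auto
  also have "\<dots> = ennreal (T powr (p - 1) * (c * K powr p * growth r * T))"
    by (intro ennreal_mult'[symmetric]) auto
  also have "T powr (p - 1) * (c * K powr p * growth r * T) = (C powr ((hdim TYPE('n) + \<bar>\<alpha>\<bar>) / p) * T * K) powr p * growth r"
  proof -
    have "T powr (p - 1) * T = T powr p"
      using T(2) p by (cases "T = 0") (auto simp: powr_diff)
    then show ?thesis
      using T(2) K(1) p by (simp add: powr_mult powr_powr c_def mult_ac)
  qed
  finally show "energy (\<lambda>x. \<integral>y. of_real (\<phi> y) * f (B y *v x) \<partial>lborel) r
       \<le> ennreal ((C powr ((hdim TYPE('n) + \<bar>\<alpha>\<bar>) / p) * T * K) powr p * growth r)" .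
qed

text \<open>
  It remains to transfer the bound from Borel representatives to the given functions. If \<open>f = g\<close>
  outside the null set \<open>Z\<close>, then \<open>A(y) x \<in> Z\<close> only for a null set of \<open>x\<close>, for each \<open>y\<close> with
  \<open>\<Phi> y \<noteq> 0\<close> outside a null set, because \<open>A(y)\<close> is a quasi-dilation; exchanging the quantifiers by
  Fubini, for almost every \<open>x\<close> the two integrands agree for almost every \<open>y\<close>.
\<close>
lemma hausdorff_bounded_if_integral_finite:
  fixes \<Phi> :: "'n heis \<Rightarrow> real" and A :: "'n heis \<Rightarrow> 'n heis_mat"
  assumes \<Phi>: "\<Phi> \<in> borel_measurable lebesgue" and \<Phi>0: "\<And>y. 0 \<le> \<Phi> y"
    and A: "A \<in> borel_measurable lebesgue"
    and qd: "AE y in lborel. \<Phi> y \<noteq> 0 \<longrightarrow> quasi_dilation C (enn2real (heis_matnorm (A y))) (A y)"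
    and fin: "(\<integral>\<^sup>+y. ennreal (\<Phi> y / heis_norm y ^ heis_dim TYPE('n) * enn2real (heis_matnorm (A y)) powr (\<gamma> * l)) \<partial>lborel) < \<infinity>"
  shows "hausdorff_bounded \<Phi> A mspace mnorm"
proof -
  let ?k = "\<lambda>y::'n heis. \<Phi> y / heis_norm y ^ heis_dim TYPE('n)"
  have [measurable]: "heis_norm \<in> borel_measurable (lebesgue :: 'n heis measure)"
    by (rule measurable_completion) simp
  have "?k \<in> borel_measurable lebesgue"
    using \<Phi> by measurable
  then obtain \<phi>1 where \<phi>1 [measurable]: "\<phi>1 \<in> borel_measurable borel" and \<phi>1_eq: "AE y in lborel. ?k y = \<phi>1 y"
    by (rule lebesgue_borel_representative)
  \<comment> \<open>The representative may be negative on a null set.\<close>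
  define \<phi> where "\<phi> y = \<bar>\<phi>1 y\<bar>" for y
  have \<phi> [measurable]: "\<phi> \<in> borel_measurable borel" unfolding \<phi>_def by measurable
  have \<phi>0: "0 \<le> \<phi> y" for y by (simp add: \<phi>_def)
  have \<phi>_eq: "AE y in lborel. ?k y = \<phi> y"
    using \<phi>1_eq
  proof eventually_elim
    case (elim y)
    have "0 \<le> ?k y" using \<Phi>0 by simp
    then show ?case using elim by (simp add: \<phi>_def)
  qed
  obtain B where B [measurable]: "B \<in> borel_measurable borel" and B_eq: "AE y in lborel. A y = B y"
    using lebesgue_borel_representative[OF A] .
  define b where "b y = enn2real (heis_matnorm (B y))" for y
  have b [measurable]: "b \<in> borel_measurable borel" unfolding b_def by measurable
  have qd': "AE y in lborel. \<phi> y \<noteq> 0 \<longrightarrow> quasi_dilation C (b y) (B y)"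
    using qd \<phi>_eq B_eq by eventually_elim (auto simp: b_def)
  define T where "T = enn2real (\<integral>\<^sup>+y. ennreal (\<phi> y * b y powr (\<gamma> * l)) \<partial>lborel)"
  have "(\<integral>\<^sup>+y. ennreal (\<phi> y * b y powr (\<gamma> * l)) \<partial>lborel)
     = (\<integral>\<^sup>+y. ennreal (?k y * enn2real (heis_matnorm (A y)) powr (\<gamma> * l)) \<partial>lborel)"
    using \<phi>_eq B_eq by (intro nn_integral_cong_AE, eventually_elim) (simp add: b_def)
  then have T: "(\<integral>\<^sup>+y. ennreal (\<phi> y * b y powr (\<gamma> * l)) \<partial>lborel) = ennreal T" "0 \<le> T"
    using fin by (simp_all add: T_def)
  define c where "c = C powr ((hdim TYPE('n) + \<bar>\<alpha>\<bar>) / p) * T"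
  have c: "0 \<le> c" using T by (simp add: c_def)
  have "(AE x in lebesgue. integrable lebesgue (hausdorff_integrand \<Phi> A f x)) \<and>
      hausdorff_op \<Phi> A f \<in> mspace \<and> mnorm (hausdorff_op \<Phi> A f) \<le> ennreal c * mnorm f"
    if f: "f \<in> mspace" for f
  proof -
    obtain K where K: "0 \<le> K" "mnorm f = ennreal K" and f_meas: "f \<in> borel_measurable lebesgue"
      using mspaceE[OF f] .
    obtain g where g [measurable]: "g \<in> borel_measurable borel" and fg: "AE x in lborel. f x = g x"
      using lebesgue_borel_representative[OF f_meas] .
    have "energy f r \<le> ennreal (K powr p * growth r)" if "0 < r" for r
      using K mnorm_le_iff[of K f] that by simp
    moreover have "energy f r = energy g r" for r
      by (rule energy_cong_AE) (use fg in auto)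
    ultimately have Kg: "\<And>r. 0 < r \<Longrightarrow> energy g r \<le> ennreal (K powr p * growth r)"
      by simp
    have average_integrable: "AE x in lborel. integrable lborel (\<lambda>y. of_real (\<phi> y) * g (B y *v x))"
      by (rule hausdorff_average_bound(1)[OF \<phi> \<phi>0 B b qd' T g K(1)]) (rule Kg)
    have average_energy: "energy (\<lambda>x. \<integral>y. of_real (\<phi> y) * g (B y *v x) \<partial>lborel) r \<le> ennreal ((c * K) powr p * growth r)"
      if "0 < r" for r
      unfolding c_def by (rule hausdorff_average_bound(2)[OF \<phi> \<phi>0 B b qd' T g K(1)]) (rule Kg that | assumption)+
    obtain Z where Z: "Z \<in> null_sets lborel" "{x. f x \<noteq> g x} \<subseteq> Z"
      using fg by (auto elim!: AE_E simp: null_sets_def)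
    have Zfg: "f z = g z" if "z \<notin> Z" for z using Z(2) that by blast
    have [measurable]: "Z \<in> sets borel" using Z by auto
    have "AE y in lborel. AE x in lborel. \<phi> y \<noteq> 0 \<longrightarrow> B y *v x \<notin> Z"
      using qd'
    proof eventually_elim
      case (elim y)
      show ?case
      proof (cases "\<phi> y = 0")
        case False
        then have M: "quasi_dilation C (b y) (B y)" using elim by simp
        have "(\<integral>\<^sup>+x. indicator Z (B y *v x) \<partial>lborel)
            \<le> ennreal ((C / b y) powr hdim TYPE('n)) * (\<integral>\<^sup>+x. indicator Z x \<partial>lborel)"
          by (rule nn_integral_quasi_dilation[OF M]) measurable
        also have "\<dots> = 0" using Z by (simp add: null_sets_def)
        finally have "(\<integral>\<^sup>+x. indicator Z (B y *v x) \<partial>lborel) = 0" by simp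
        then have "AE x in lborel. indicator Z (B y *v x) = (0::ennreal)"
          by (subst (asm) nn_integral_0_iff_AE) auto
        then show ?thesis
          by eventually_elim (auto simp: indicator_def)
      qed simp
    qed
    then have hit: "AE x in lborel. AE y in lborel. \<phi> y \<noteq> 0 \<longrightarrow> B y *v x \<notin> Z"
      by (subst lborel_pair.AE_commute) measurable
    have integrand: "AE x in lborel. AE y in lborel. of_real (\<phi> y) * g (B y *v x) = hausdorff_integrand \<Phi> A f x y"
      using hit
    proof eventually_elim
      case (elim x)
      show ?case
        using elim \<phi>_eq B_eq by eventually_elim (use Zfg in \<open>auto simp: hausdorff_integrand_def\<close>)
    qed
    define H where "H x = (\<integral>y. of_real (\<phi> y) * g (B y *v x) \<partial>lborel)" for x
    have op: "AE x in lborel. integrable lebesgue (hausdorff_integrand \<Phi> A f x) \<and> H x = hausdorff_op \<Phi> A f x"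
      using integrand average_integrable
    proof eventually_elim
      case (elim x)
      have m: "(\<lambda>y. of_real (\<phi> y) * g (B y *v x)) \<in> borel_measurable lborel"
        by measurable
      then have m1: "(\<lambda>y. of_real (\<phi> y) * g (B y *v x)) \<in> borel_measurable lebesgue"
        by (rule measurable_completion)
      have ae: "AE y in lebesgue. of_real (\<phi> y) * g (B y *v x) = hausdorff_integrand \<Phi> A f x y"
        by (rule AE_completion) (rule elim)
      have m2: "hausdorff_integrand \<Phi> A f x \<in> borel_measurable lebesgue"
        by (rule borel_measurable_AE[OF m1 ae])
      have "integrable lebesgue (\<lambda>y. of_real (\<phi> y) * g (B y *v x))"
        using elim(2) m by (simp add: integrable_completion)
      then have "integrable lebesgue (hausdorff_integrand \<Phi> A f x)"
        using integrable_cong_AE[OF m1 m2 ae] by simp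
      moreover have "H x = (\<integral>y. of_real (\<phi> y) * g (B y *v x) \<partial>lebesgue)"
        unfolding H_def using m by (simp add: integral_completion)
      then have "H x = hausdorff_op \<Phi> A f x"
        unfolding hausdorff_op_def using integral_cong_AE[OF m1 m2 ae] by simp
      ultimately show ?case by blast
    qed
    have "H \<in> borel_measurable lborel"
      unfolding H_def by measurable
    then have "H \<in> borel_measurable lebesgue"
      by (rule measurable_completion)
    then have op_meas: "hausdorff_op \<Phi> A f \<in> borel_measurable lebesgue"
      by (rule borel_measurable_AE) (rule AE_completion, use op in eventually_elim, blast)
    have "energy (hausdorff_op \<Phi> A f) r \<le> ennreal ((c * K) powr p * growth r)" if r: "0 < r" for r
    proof -
      have "energy (hausdorff_op \<Phi> A f) r = energy H r"
        using op by (intro energy_cong_AE, eventually_elim) simp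
      then show ?thesis using average_energy[OF r] by (simp add: H_def[abs_def])
    qed
    then have le: "mnorm (hausdorff_op \<Phi> A f) \<le> ennreal (c * K)"
      using c K by (subst mnorm_le_iff) auto
    moreover have "hausdorff_op \<Phi> A f \<in> mspace"
      using c K by (intro mspaceI[OF op_meas le]) auto
    moreover have "AE x in lebesgue. integrable lebesgue (hausdorff_integrand \<Phi> A f x)"
      by (rule AE_completion, use op in eventually_elim, blast)
    ultimately show ?thesis
      using c K by (simp add: ennreal_mult)
  qed
  then show ?thesis
    unfolding hausdorff_bounded_def by blast
qed

section \<open>Boundedness implies finiteness of the integral\<close>

definition test_fun :: "real \<Rightarrow> 'n heis \<Rightarrow> complex" where
  "test_fun e x = of_real (if 1 \<le> heis_norm x then heis_norm x powr (\<gamma> * l - e) else 0)"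

lemma test_fun_measurable [measurable]: "test_fun e \<in> borel_measurable borel"
  unfolding test_fun_def by measurable

text \<open>
  On the ball of radius \<open>r\<close> the integrand \<open>N\<^sup>(\<^sup>\<gamma>\<^sup>l\<^sup>-\<^sup>e\<^sup>)\<^sup>p\<^sup>+\<^sup>\<alpha>\<close> is the product of \<open>N\<^sup>\<gamma>\<^sup>(\<^sup>1\<^sup>+\<^sup>p\<^sup>l\<^sup>) \<le> r\<^sup>\<gamma>\<^sup>(\<^sup>1\<^sup>+\<^sup>p\<^sup>l\<^sup>)\<close>, which
  is the allowed growth, and \<open>N\<^sup>-\<^sup>Q\<^sup>-\<^sup>e\<^sup>p\<close>, which is integrable at infinity. This works uniformly down to the
  endpoint \<open>l = - 1 / p\<close>, where no growth is allowed. The norm is positive, so it can be cancelled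
  later.
\<close>
lemma test_fun_mspace:
  assumes e: "0 < e"
  obtains K where "0 < K" "mnorm (test_fun e) = ennreal K" "test_fun e \<in> mspace"
proof -
  define J where "J = (\<integral>\<^sup>+x\<in>{x::'n heis. 1 \<le> heis_norm x}. ennreal (heis_norm x powr (- hdim TYPE('n) - e * p)) \<partial>lborel)"
  have "J < \<infinity>"
    unfolding J_def using e p by (intro nn_integral_heis_norm_powr_at_infinity) auto
  then obtain j where j: "J = ennreal j" "0 \<le> j"
    by (cases J) auto
  define K where "K = (j / growth 1) powr (1 / p)"
  have "0 < growth 1" by (rule growth_pos) simp
  then have K: "0 \<le> K" "K powr p = j / growth 1"
    using j p by (auto simp: K_def powr_powr)
  have "energy (test_fun e) r \<le> ennreal (K powr p * growth r)" if r: "0 < r" for r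
  proof -
    have "energy (test_fun e) r \<le> (\<integral>\<^sup>+x. ennreal (r powr (\<gamma> * (1 + p * l))) *
        (ennreal (heis_norm x powr (- hdim TYPE('n) - e * p)) * indicator {x::'n heis. 1 \<le> heis_norm x} x) \<partial>lborel)"
      unfolding energy_def
    proof (intro nn_integral_mono)
      fix x :: "'n heis"
      show "ennreal (cmod (test_fun e x) powr p * heis_norm x powr \<alpha>) * indicator {x. heis_norm x < r} x
        \<le> ennreal (r powr (\<gamma> * (1 + p * l))) *
          (ennreal (heis_norm x powr (- hdim TYPE('n) - e * p)) * indicator {x. 1 \<le> heis_norm x} x)"
      proof (cases "1 \<le> heis_norm x \<and> heis_norm x < r")
        case True
        have "cmod (test_fun e x) powr p * heis_norm x powr \<alpha> = heis_norm x powr ((\<gamma> * l - e) * p + \<alpha>)"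
          using True by (simp add: test_fun_def powr_powr powr_add)
        also have "(\<gamma> * l - e) * p + \<alpha> = \<gamma> * (1 + p * l) + (- hdim TYPE('n) - e * p)"
          by (simp add: \<gamma>_def algebra_simps)
        also have "heis_norm x powr \<dots> = heis_norm x powr (\<gamma> * (1 + p * l)) * heis_norm x powr (- hdim TYPE('n) - e * p)"
          by (rule powr_add)
        also have "\<dots> \<le> r powr (\<gamma> * (1 + p * l)) * heis_norm x powr (- hdim TYPE('n) - e * p)"
          using True lp \<gamma>_pos by (intro mult_right_mono powr_mono2) auto
        finally show ?thesis
          using True by (simp add: ennreal_mult[symmetric])
      next
        case False
        then show ?thesis
          using p by (auto simp: test_fun_def indicator_def)
      qed
    qed
    also have "\<dots> = ennreal (r powr (\<gamma> * (1 + p * l))) * J"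
      unfolding J_def by (rule nn_integral_cmult) measurable
    also have "\<dots> = ennreal (K powr p * growth r)"
      using j growth_scale[of r 1] \<open>0 < growth 1\<close> r K by (simp add: ennreal_mult[symmetric] mult.commute)
    finally show ?thesis .
  qed
  then have le: "mnorm (test_fun e) \<le> ennreal K"
    using K by (subst mnorm_le_iff) auto
  have "\<not> mnorm (test_fun e) \<le> ennreal 0"
  proof
    assume "mnorm (test_fun e) \<le> ennreal 0"
    then have "energy (test_fun e) 2 \<le> ennreal (0 powr p * growth 2)"
      unfolding mnorm_le_iff[OF order_refl] by simp
    then have "energy (test_fun e) 2 = 0" by simp
    then have "AE x in lborel. ennreal (cmod (test_fun e x) powr p * heis_norm x powr \<alpha>) * indicator {x. heis_norm x < 2} x = 0"
      unfolding energy_def by (subst (asm) nn_integral_0_iff_AE) auto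
    then have "AE x in lborel. x \<notin> {x::'n heis. 1 < heis_norm x \<and> heis_norm x < 2}"
    proof eventually_elim
      case (elim x)
      then show ?case
        by (auto simp: indicator_def test_fun_def ennreal_eq_0_iff)
           (smt (verit) heis_norm_0 powr_gt_zero mult_pos_pos heis_norm_eq_0_iff)
    qed
    moreover have "open {x::'n heis. 1 < heis_norm x \<and> heis_norm x < 2}"
      by (intro open_Collect_conj open_Collect_less continuous_intros)
    moreover obtain x :: "'n heis" where "heis_norm x = 3/2"
      using exists_heis_norm_eq[of "3/2"] by auto
    then have "x \<in> {x::'n heis. 1 < heis_norm x \<and> heis_norm x < 2}"
      by simp
    ultimately show False
      using not_AE_not_in_open by blast
  qed
  then have "mnorm (test_fun e) \<noteq> 0" by auto
  moreover have space: "test_fun e \<in> mspace"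
    by (rule mspaceI[OF _ le K(1)]) (rule measurable_completion, measurable)
  ultimately show thesis
    using that mspaceE[OF space] by (metis ennreal_0 order_le_less)
qed

lemma energy_dilation:
  assumes s: "0 < s" and [measurable]: "f \<in> borel_measurable borel"
  shows "energy f (s * r) = ennreal (s powr \<gamma>) * energy (\<lambda>x. f (heis_dil s x)) r"
proof -
  have "energy f (s * r) = ennreal (s powr hdim TYPE('n)) *
      (\<integral>\<^sup>+x. ennreal (cmod (f (heis_dil s x)) powr p * heis_norm (heis_dil s x) powr \<alpha>) * indicator {x. heis_norm x < s * r} (heis_dil s x) \<partial>lborel)"
    unfolding energy_def by (rule nn_integral_heis_dil[OF s]) measurable
  also have "\<dots> = ennreal (s powr hdim TYPE('n)) * (\<integral>\<^sup>+x. ennreal (s powr \<alpha>) *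
      (ennreal (cmod (f (heis_dil s x)) powr p * heis_norm x powr \<alpha>) * indicator {x. heis_norm x < r} x) \<partial>lborel)"
  proof (rule arg_cong2[where f="(*)", OF refl nn_integral_cong])
    fix x :: "'n heis"
    have "indicator {x. heis_norm x < s * r} (heis_dil s x) = (indicator {x. heis_norm x < r} x :: ennreal)"
      using s by (auto simp: indicator_def)
    then show "ennreal (cmod (f (heis_dil s x)) powr p * heis_norm (heis_dil s x) powr \<alpha>) * indicator {x. heis_norm x < s * r} (heis_dil s x)
       = ennreal (s powr \<alpha>) * (ennreal (cmod (f (heis_dil s x)) powr p * heis_norm x powr \<alpha>) * indicator {x. heis_norm x < r} x)"
      using s by (simp add: powr_mult ennreal_mult mult_ac)
  qed
  also have "\<dots> = ennreal (s powr hdim TYPE('n)) * (ennreal (s powr \<alpha>) * energy (\<lambda>x. f (heis_dil s x)) r)"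
    unfolding energy_def by (subst nn_integral_cmult) auto
  also have "\<dots> = ennreal (s powr \<gamma>) * energy (\<lambda>x. f (heis_dil s x)) r"
    by (simp add: \<gamma>_def powr_add ennreal_mult mult.assoc)
  finally show ?thesis .
qed

text \<open>The exact scaling of the Morrey norm, in the direction that bounds \<open>f\<close> by its dilate.\<close>
lemma mnorm_dilation_le:
  assumes d: "0 < d" and f: "f \<in> borel_measurable borel" and K: "0 \<le> K"
    and le: "\<And>r. 0 < r \<Longrightarrow> energy (\<lambda>x. f (heis_dil d x)) r \<le> ennreal (K powr p * growth r)"
  shows "mnorm f \<le> ennreal (d powr - (\<gamma> * l) * K)"
proof (subst mnorm_le_iff, goal_cases)
  case 2
  show ?case
  proof (intro allI impI)
    fix r :: real assume r: "0 < r"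
    have "energy f r = energy f (d * (r / d))" using d by simp
    also have "\<dots> = ennreal (d powr \<gamma>) * energy (\<lambda>x. f (heis_dil d x)) (r / d)"
      by (rule energy_dilation[OF d f])
    also have "\<dots> \<le> ennreal (d powr \<gamma>) * ennreal (K powr p * growth (r / d))"
      using d r by (intro mult_left_mono le) auto
    also have "\<dots> = ennreal (d powr \<gamma> * (K powr p * growth (r / d)))"
      by (rule ennreal_mult'[symmetric]) auto
    also have "growth (r / d) = (1 / d) powr (\<gamma> * (1 + p * l)) * growth r"
      using growth_scale[of "1 / d" r] d r by simp
    also have "d powr \<gamma> * (K powr p * ((1 / d) powr (\<gamma> * (1 + p * l)) * growth r))
        = (d powr \<gamma> * (1 / d) powr (\<gamma> * (1 + p * l))) * (K powr p * growth r)"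
      by (simp add: mult_ac)
    also have "d powr \<gamma> * (1 / d) powr (\<gamma> * (1 + p * l)) = d powr (- (\<gamma> * l) * p)"
    proof -
      have "d powr \<gamma> * (1 / d) powr (\<gamma> * (1 + p * l)) = d powr (\<gamma> - \<gamma> * (1 + p * l))"
        using d by (simp add: powr_divide powr_diff)
      also have "\<gamma> - \<gamma> * (1 + p * l) = - (\<gamma> * l) * p" by (simp add: algebra_simps)
      finally show ?thesis .
    qed
    also have "d powr (- (\<gamma> * l) * p) * (K powr p * growth r) = (d powr - (\<gamma> * l) * K) powr p * growth r"
      using d K by (simp add: powr_mult powr_powr)
    finally show "energy f r \<le> ennreal ((d powr - (\<gamma> * l) * K) powr p * growth r)" .
  qed
qed (use K in auto)

text \<open>
  Let \<open>t = \<gamma> l - e < 0\<close> and \<open>N(x) \<ge> 1 / d\<close>. Where \<open>a(y) \<ge> C d\<close>, the point \<open>A(y) x\<close> has norm at least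
  \<open>d N(x) \<ge> 1\<close>, so it lies where the test function is a power and
  \<open>f(A(y) x) = N(A(y) x)\<^sup>t \<ge> N(x)\<^sup>t a(y)\<^sup>t\<close>. Integrating in \<open>y\<close>, the image of the test function \<open>f\<close> is at
  least \<open>m N(x)\<^sup>t\<close>, that is, \<open>m d\<^sup>-\<^sup>t\<close> times the dilate of \<open>f\<close> by \<open>d\<close>. Comparing norms gives
  \<open>m d\<^sup>-\<^sup>t d\<^sup>\<gamma>\<^sup>l \<le> c\<close>.
\<close>
lemma hausdorff_bounded_truncated_integral_le:
  fixes \<Phi> :: "'n heis \<Rightarrow> real" and A :: "'n heis \<Rightarrow> 'n heis_mat"
  assumes \<Phi>: "\<Phi> \<in> borel_measurable lebesgue" and \<Phi>0: "\<And>y. 0 \<le> \<Phi> y"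
    and a [measurable]: "a \<in> borel_measurable lebesgue"
    and qd: "AE y in lborel. \<Phi> y \<noteq> 0 \<longrightarrow> quasi_dilation C (a y) (A y)"
    and c: "0 \<le> c"
    and bdd: "\<And>f. f \<in> mspace \<Longrightarrow> (AE x in lborel. integrable lebesgue (hausdorff_integrand \<Phi> A f x)) \<and>
      hausdorff_op \<Phi> A f \<in> mspace \<and> mnorm (hausdorff_op \<Phi> A f) \<le> ennreal c * mnorm f"
    and e: "0 < e" and d: "0 < d"
  shows "(\<integral>\<^sup>+y. ennreal (if C * d \<le> a y then \<Phi> y / heis_norm y ^ heis_dim TYPE('n) * a y powr (\<gamma> * l - e) else 0) \<partial>lebesgue)
      \<le> ennreal (c * d powr - e)"
proof -
  let ?k = "\<lambda>y::'n heis. \<Phi> y / heis_norm y ^ heis_dim TYPE('n)"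
  let ?f = "test_fun e"
  let ?H = "hausdorff_op \<Phi> A ?f"
  define t where "t = \<gamma> * l - e"
  have "\<gamma> * l < 0" using \<gamma>_pos l by (rule mult_pos_neg)
  then have t: "t < 0" using e by (simp add: t_def)
  have k0: "0 \<le> ?k y" for y using \<Phi>0 by simp
  have [measurable]: "heis_norm \<in> borel_measurable (lebesgue :: 'n heis measure)"
    by (rule measurable_completion) simp
  note \<Phi> [measurable]
  define G where "G y = (if C * d \<le> a y then ?k y * a y powr t else 0)" for y
  have [measurable]: "G \<in> borel_measurable lebesgue" unfolding G_def by measurable
  have G0: "0 \<le> G y" for y
    using mult_nonneg_nonneg[OF k0[of y] powr_ge_zero] by (simp add: G_def)
  obtain K where K: "0 < K" "mnorm ?f = ennreal K" and f: "?f \<in> mspace"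
    using test_fun_mspace[OF e] .
  note b = bdd[OF f]
  have ptw: "AE x in lborel. 1 / d \<le> heis_norm x \<longrightarrow>
      ennreal (heis_norm x powr t) * (\<integral>\<^sup>+y. ennreal (G y) \<partial>lebesgue) \<le> ennreal (cmod (?H x))"
    using b[THEN conjunct1]
  proof eventually_elim
    case (elim x)
    show ?case
    proof
      assume x: "1 / d \<le> heis_norm x"
      then have x0: "0 < heis_norm x" using d by (smt (verit) zero_less_divide_1_iff)
      \<comment> \<open>The integrand is real and nonnegative, so no cancellation occurs in the operator.\<close>
      have real: "hausdorff_integrand \<Phi> A ?f x y = of_real (cmod (hausdorff_integrand \<Phi> A ?f x y))" for y
        using \<Phi>0[of y] by (simp add: hausdorff_integrand_def test_fun_def norm_mult norm_divide norm_power)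
      have "ennreal (heis_norm x powr t) * (\<integral>\<^sup>+y. ennreal (G y) \<partial>lebesgue)
          = (\<integral>\<^sup>+y. ennreal (heis_norm x powr t) * ennreal (G y) \<partial>lebesgue)"
        by (rule nn_integral_cmult[symmetric]) measurable
      also have "\<dots> = (\<integral>\<^sup>+y. ennreal (heis_norm x powr t * G y) \<partial>lebesgue)"
        using G0 by (intro nn_integral_cong) (simp add: ennreal_mult)
      also have "\<dots> \<le> (\<integral>\<^sup>+y. ennreal (cmod (hausdorff_integrand \<Phi> A ?f x y)) \<partial>lebesgue)"
      proof (rule nn_integral_mono_AE)
        from qd have "AE y in lborel. ennreal (heis_norm x powr t * G y) \<le> ennreal (cmod (hausdorff_integrand \<Phi> A ?f x y))"
        proof eventually_elim
          case (elim y)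
          show ?case
          proof (cases "\<Phi> y \<noteq> 0 \<and> C * d \<le> a y")
            case True
            then have M: "quasi_dilation C (a y) (A y)" using elim by simp
            note D = quasi_dilationD[OF M]
            have C: "1 \<le> C" by (rule quasi_dilation_const_ge_1[OF M])
            have "1 \<le> d * heis_norm x" using x d by (simp add: field_simps)
            also have "\<dots> \<le> a y / C * heis_norm x"
              using True C by (intro mult_right_mono) (auto simp: field_simps)
            also have "\<dots> \<le> heis_norm (A y *v x)" by (rule quasi_dilation_heis_norm_ge[OF M])
            finally have ge: "1 \<le> heis_norm (A y *v x)" .
            have "heis_norm x powr t * a y powr t = (a y * heis_norm x) powr t"
              using D(1) by (simp add: powr_mult mult.commute)
            also have "\<dots> \<le> heis_norm (A y *v x) powr t"
              using t ge D(2)[of x] by (intro powr_mono2') auto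
            finally have "?k y * (heis_norm x powr t * a y powr t) \<le> ?k y * heis_norm (A y *v x) powr t"
              using k0 by (intro mult_left_mono)
            also have "\<dots> = cmod (hausdorff_integrand \<Phi> A ?f x y)"
              using ge k0[of y] by (simp add: hausdorff_integrand_def test_fun_def t_def norm_mult norm_divide norm_power \<Phi>0)
            finally show ?thesis
              using True by (intro ennreal_leI) (simp add: G_def mult_ac)
          qed (auto simp: G_def)
        qed
        then show "AE y in lebesgue. ennreal (heis_norm x powr t * G y) \<le> ennreal (cmod (hausdorff_integrand \<Phi> A ?f x y))"
          by (rule AE_completion)
      qed
      also have "\<dots> = ennreal (\<integral>y. cmod (hausdorff_integrand \<Phi> A ?f x y) \<partial>lebesgue)"
        using elim by (intro nn_integral_eq_integral integrable_norm) auto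
      also have "(\<integral>y. cmod (hausdorff_integrand \<Phi> A ?f x y) \<partial>lebesgue) = cmod (?H x)"
      proof -
        have "?H x = (\<integral>y. of_real (cmod (hausdorff_integrand \<Phi> A ?f x y)) \<partial>lebesgue)"
          unfolding hausdorff_op_def by (intro Bochner_Integration.integral_cong refl real)
        also have "\<dots> = of_real (\<integral>y. cmod (hausdorff_integrand \<Phi> A ?f x y) \<partial>lebesgue)"
          by simp
        finally show ?thesis by (simp add: integral_nonneg_AE)
      qed
      finally show "ennreal (heis_norm x powr t) * (\<integral>\<^sup>+y. ennreal (G y) \<partial>lebesgue) \<le> ennreal (cmod (?H x))" .
    qed
  qed
  have "(\<integral>\<^sup>+y. ennreal (G y) \<partial>lebesgue) \<noteq> \<infinity>"
  proof
    assume inf: "(\<integral>\<^sup>+y. ennreal (G y) \<partial>lebesgue) = \<infinity>"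
    from ptw have "AE x in lborel. x \<notin> {x::'n heis. 1 / d < heis_norm x}"
    proof eventually_elim
      case (elim x)
      show ?case
      proof
        assume "x \<in> {x::'n heis. 1 / d < heis_norm x}"
        then have x: "1 / d \<le> heis_norm x" "x \<noteq> 0" using d by (auto simp: not_less[symmetric] dest: order.asym)
        with elim inf have "ennreal (heis_norm x powr t) * \<infinity> \<le> ennreal (cmod (?H x))" by simp
        then show False using x(2) by (simp add: ennreal_mult_top ennreal_eq_0_iff top_unique split: if_splits)
      qed
    qed
    moreover have "open {x::'n heis. 1 / d < heis_norm x}"
      by (intro open_Collect_less continuous_intros)
    moreover obtain x :: "'n heis" where "heis_norm x = 1 / d + 1"
      using exists_heis_norm_eq[of "1 / d + 1"] d by auto
    then have "x \<in> {x::'n heis. 1 / d < heis_norm x}" by simp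
    ultimately show False using not_AE_not_in_open by blast
  qed
  then obtain m where m: "(\<integral>\<^sup>+y. ennreal (G y) \<partial>lebesgue) = ennreal m" "0 \<le> m"
    by (cases "\<integral>\<^sup>+y. ennreal (G y) \<partial>lebesgue") auto
  have "m \<le> c * d powr - e"
  proof (cases "m = 0")
    case False
    then have m0: "0 < m" using m by simp
    define q where "q = m * d powr - t"
    have q: "0 < q" using m0 d by (simp add: q_def)
    \<comment> \<open>Where \<open>N(x) < 1 / d\<close> the dilated test function vanishes.\<close>
    have below: "AE x in lborel. q * cmod (?f (heis_dil d x)) \<le> cmod (?H x)"
      using ptw
    proof eventually_elim
      case (elim x)
      show ?case
      proof (cases "1 / d \<le> heis_norm x")
        case True
        then have dx: "1 \<le> d * heis_norm x" using d by (simp add: field_simps)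
        have "q * cmod (?f (heis_dil d x)) = m * heis_norm x powr t"
          using d dx by (simp add: q_def test_fun_def t_def[symmetric] powr_mult powr_minus norm_mult)
        also have "\<dots> \<le> cmod (?H x)"
          using elim True m by (simp add: ennreal_mult[symmetric] mult.commute)
        finally show ?thesis .
      next
        case False
        then have "\<not> 1 \<le> d * heis_norm x" using d by (simp add: field_simps)
        then show ?thesis using d by (simp add: test_fun_def)
      qed
    qed
    have HK: "mnorm ?H \<le> ennreal (c * K)"
      using b K c by (simp add: ennreal_mult)
    have "energy (\<lambda>x. ?f (heis_dil d x)) r \<le> ennreal ((c * K / q) powr p * growth r)" if r: "0 < r" for r
    proof -
      have "energy (\<lambda>x. ?f (heis_dil d x)) r \<le> (\<integral>\<^sup>+x. ennreal ((1 / q) powr p) *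
          (ennreal (cmod (?H x) powr p * heis_norm x powr \<alpha>) * indicator {x. heis_norm x < r} x) \<partial>lborel)"
        unfolding energy_def using below
      proof (intro nn_integral_mono_AE, eventually_elim)
        case (elim x)
        have "cmod (?f (heis_dil d x)) \<le> 1 / q * cmod (?H x)"
          using elim q by (simp add: field_simps)
        then have "cmod (?f (heis_dil d x)) powr p \<le> (1 / q * cmod (?H x)) powr p"
          using p by (intro powr_mono2) auto
        then have "cmod (?f (heis_dil d x)) powr p * heis_norm x powr \<alpha> \<le> (1 / q) powr p * (cmod (?H x) powr p * heis_norm x powr \<alpha>)"
          using q by (subst (asm) powr_mult) (auto simp: mult.assoc[symmetric] intro!: mult_right_mono)
        then show ?case
          by (auto simp: indicator_def ennreal_mult'[symmetric] intro!: ennreal_leI)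
      qed
      also have "\<dots> = ennreal ((1 / q) powr p) * (\<integral>\<^sup>+x. 
          (ennreal (cmod (?H x) powr p * heis_norm x powr \<alpha>) * indicator {x. heis_norm x < r} x) \<partial>lebesgue)"
      proof -
        have [measurable]: "?H \<in> borel_measurable lebesgue"
          using b by (simp add: morrey_space_def Lp_loc_def)
        have "{x::'n heis. heis_norm x < r} \<in> sets borel" by measurable
        then have [measurable]: "{x::'n heis. heis_norm x < r} \<in> sets lebesgue" by simp
        show ?thesis
          unfolding nn_integral_completion[of lborel, symmetric]
          by (rule nn_integral_cmult) measurable
      qed
      also have "\<dots> = ennreal ((1 / q) powr p) * energy ?H r"
        by (simp add: energy_def nn_integral_completion)
      also have "\<dots> \<le> ennreal ((1 / q) powr p) * ennreal ((c * K) powr p * growth r)"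
        using HK r c K mnorm_le_iff[of "c * K" ?H] by (intro mult_left_mono) auto
      also have "\<dots> = ennreal ((c * K / q) powr p * growth r)"
        using c K q by (simp add: ennreal_mult'[symmetric] powr_divide powr_mult)
      finally show ?thesis .
    qed
    then have "mnorm ?f \<le> ennreal (d powr - (\<gamma> * l) * (c * K / q))"
      using c K q by (intro mnorm_dilation_le[OF d]) auto
    then have "K \<le> d powr - (\<gamma> * l) * (c * K / q)"
      using K c q by (simp add: ennreal_le_iff)
    then have "K * 1 \<le> K * (d powr - (\<gamma> * l) * (c / q))"
      by (simp add: mult_ac)
    then have "1 \<le> d powr - (\<gamma> * l) * (c / q)"
      using K(1) by (simp only: mult_le_cancel_left_pos)
    then have "q \<le> d powr - (\<gamma> * l) * c"
      using q by (simp add: field_simps)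
    then have "m * d powr - t * d powr t \<le> d powr - (\<gamma> * l) * c * d powr t"
      unfolding q_def by (intro mult_right_mono) auto
    moreover have "d powr - (\<gamma> * l) * d powr t = d powr - e" "d powr - t * d powr t = 1"
      using d by (simp_all add: t_def powr_add[symmetric])
    ultimately show ?thesis by (simp add: mult_ac)
  qed (use c in auto)
  then have "(\<integral>\<^sup>+y. ennreal (G y) \<partial>lebesgue) \<le> ennreal (c * d powr - e)"
    unfolding m(1) by (rule ennreal_leI)
  then show ?thesis unfolding G_def t_def .
qed

text \<open>
  With \<open>d = e = 1 / n\<close> the truncated integrals are bounded by \<open>c n\<^sup>1\<^sup>/\<^sup>n \<le> 2 c\<close>, because \<open>n \<le> 2\<^sup>n\<close>, while
  both the truncation and the extra exponent disappear in the limit.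
\<close>
lemma integral_finite_if_hausdorff_bounded:
  fixes \<Phi> :: "'n heis \<Rightarrow> real" and A :: "'n heis \<Rightarrow> 'n heis_mat"
  assumes \<Phi>: "\<Phi> \<in> borel_measurable lebesgue" and \<Phi>0: "\<And>y. 0 \<le> \<Phi> y"
    and a [measurable]: "a \<in> borel_measurable lebesgue"
    and qd: "AE y in lborel. \<Phi> y \<noteq> 0 \<longrightarrow> quasi_dilation C (a y) (A y)"
    and bounded: "hausdorff_bounded \<Phi> A mspace mnorm"
  shows "(\<integral>\<^sup>+y. ennreal (\<Phi> y / heis_norm y ^ heis_dim TYPE('n) * a y powr (\<gamma> * l)) \<partial>lebesgue) < \<infinity>"
proof -
  let ?k = "\<lambda>y::'n heis. \<Phi> y / heis_norm y ^ heis_dim TYPE('n)"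
  note \<Phi> [measurable]
  have [measurable]: "heis_norm \<in> borel_measurable (lebesgue :: 'n heis measure)"
    by (rule measurable_completion) simp
  obtain c0 where c0: "\<And>f. f \<in> mspace \<Longrightarrow> (AE x in lebesgue. integrable lebesgue (hausdorff_integrand \<Phi> A f x)) \<and>
      hausdorff_op \<Phi> A f \<in> mspace \<and> mnorm (hausdorff_op \<Phi> A f) \<le> ennreal c0 * mnorm f"
    using bounded unfolding hausdorff_bounded_def by blast
  \<comment> \<open>A negative bound \<open>c0\<close> acts as \<open>0\<close>, since \<open>ennreal\<close> truncates.\<close>
  define c where "c = max c0 0"
  have "ennreal c0 = ennreal c" by (simp add: c_def max_def ennreal_neg)
  then have bdd: "(AE x in lborel. integrable lebesgue (hausdorff_integrand \<Phi> A f x)) \<and>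
      hausdorff_op \<Phi> A f \<in> mspace \<and> mnorm (hausdorff_op \<Phi> A f) \<le> ennreal c * mnorm f" if "f \<in> mspace" for f
    using c0[OF that] by (simp add: AE_completion_iff)
  have c: "0 \<le> c" by (simp add: c_def)
  define G where "G n y = (if C * (1 / real (Suc n)) \<le> a y then ?k y * a y powr (\<gamma> * l - 1 / real (Suc n)) else 0)" for n y
  have [measurable]: "G n \<in> borel_measurable lebesgue" for n unfolding G_def by measurable
  have le: "(\<integral>\<^sup>+y. ennreal (G n y) \<partial>lebesgue) \<le> ennreal (2 * c)" for n
  proof -
    have "(1 / real (Suc n)) powr - (1 / real (Suc n)) = real (Suc n) powr (1 / real (Suc n))"
      by (simp add: powr_minus powr_divide)
    also have "\<dots> \<le> (2 powr real (Suc n)) powr (1 / real (Suc n))"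
      by (intro powr_mono2) (use of_nat_less_two_power[of "Suc n", where 'a=real] in \<open>auto simp: powr_realpow simp del: of_nat_Suc\<close>)
    also have "\<dots> = 2" by (simp add: powr_powr)
    finally have root: "(1 / real (Suc n)) powr - (1 / real (Suc n)) \<le> 2" .
    have "(\<integral>\<^sup>+y. ennreal (G n y) \<partial>lebesgue) \<le> ennreal (c * (1 / real (Suc n)) powr - (1 / real (Suc n)))"
      unfolding G_def by (rule hausdorff_bounded_truncated_integral_le[OF \<Phi> \<Phi>0 a qd c bdd]) auto
    also have "\<dots> \<le> ennreal (2 * c)"
      using mult_left_mono[OF root c] by (intro ennreal_leI) (simp add: mult.commute)
    finally show ?thesis .
  qed
  have lim: "AE y in lebesgue. ennreal (?k y * a y powr (\<gamma> * l)) = liminf (\<lambda>n. ennreal (G n y))"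
  proof (rule AE_completion)
    show "AE y in lborel. ennreal (?k y * a y powr (\<gamma> * l)) = liminf (\<lambda>n. ennreal (G n y))"
      using qd
    proof eventually_elim
      case (elim y)
      have inv: "(\<lambda>n. 1 / real (Suc n)) \<longlonglongrightarrow> 0"
        using LIMSEQ_inverse_real_of_nat by (simp add: inverse_eq_divide)
      have "(\<lambda>n. G n y) \<longlonglongrightarrow> ?k y * a y powr (\<gamma> * l)"
      proof (cases "\<Phi> y = 0")
        case False
        then have a: "0 < a y" using elim by (auto dest: quasi_dilationD)
        have "(\<lambda>n. C * (1 / real (Suc n))) \<longlonglongrightarrow> C * 0"
          by (intro tendsto_intros inv)
        then have "eventually (\<lambda>n. C * (1 / real (Suc n)) < a y) sequentially"
          using a by (intro order_tendstoD(2)) auto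
        then have ev: "eventually (\<lambda>n. ?k y * a y powr (\<gamma> * l - 1 / real (Suc n)) = G n y) sequentially"
          by eventually_elim (simp add: G_def)
        have "(\<lambda>n. ?k y * a y powr (\<gamma> * l - 1 / real (Suc n))) \<longlonglongrightarrow> ?k y * a y powr (\<gamma> * l - 0)"
          using a by (intro tendsto_mult tendsto_const tendsto_powr tendsto_diff inv) auto
        then show ?thesis
          using tendsto_cong[OF ev] by simp
      qed (simp add: G_def cong: if_cong)
      then have "(\<lambda>n. ennreal (G n y)) \<longlonglongrightarrow> ennreal (?k y * a y powr (\<gamma> * l))"
        by (rule tendsto_ennrealI)
      then show ?case
        by (simp add: lim_imp_Liminf)
    qed
  qed
  have "(\<integral>\<^sup>+y. ennreal (?k y * a y powr (\<gamma> * l)) \<partial>lebesgue) = (\<integral>\<^sup>+y. liminf (\<lambda>n. ennreal (G n y)) \<partial>lebesgue)"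
    by (rule nn_integral_cong_AE[OF lim])
  also have "\<dots> \<le> liminf (\<lambda>n. \<integral>\<^sup>+y. ennreal (G n y) \<partial>lebesgue)"
    by (rule nn_integral_liminf) measurable
  also have "\<dots> \<le> liminf (\<lambda>n. ennreal (2 * c))"
    by (intro Liminf_mono always_eventually allI le)
  also have "\<dots> < \<infinity>" by (simp add: Liminf_const)
  finally show ?thesis .
qed

end

section \<open>The boundedness criterion\<close>

theorem theorem1p5:
  fixes p l \<alpha> C0 :: real
    and \<Phi> :: "'n::finite heis \<Rightarrow> real"
    and A :: "'n heis \<Rightarrow> 'n heis_mat"
  assumes "1 \<le> p" and "- 1 / p \<le> l" and "l < 0" and "- real (heis_dim TYPE('n)) < \<alpha>"
    and "locally_integrable \<Phi>" and "\<And>y. 0 \<le> \<Phi> y"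
    and "A \<in> borel_measurable lebesgue"
    and "AE y in lebesgue. y \<in> supp \<Phi> \<longrightarrow> det (A y) \<noteq> 0"
    and "\<And>y. y \<in> supp \<Phi> \<Longrightarrow> det (A y) \<noteq> 0 \<Longrightarrow>
           heis_matnorm (matrix_inv (A y)) \<le> ennreal C0 * inverse (heis_matnorm (A y))"
  shows "hausdorff_bounded \<Phi> A
      (morrey_space p l (\<lambda>x. heis_norm x powr \<alpha>))
      (morrey_norm p l (\<lambda>x. heis_norm x powr \<alpha>)) \<longleftrightarrow>
    (\<integral>\<^sup>+y. ennreal (\<Phi> y / heis_norm y ^ heis_dim TYPE('n))
          * ennreal_powr (heis_matnorm (A y)) ((real (heis_dim TYPE('n)) + \<alpha>) * l) \<partial>lebesgue) < \<infinity>"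
proof -
  obtain W where W: "0 < W"
    "\<And>r. 0 < r \<Longrightarrow> (\<integral>\<^sup>+x\<in>{x::'n heis. heis_norm x < r}. ennreal (heis_norm x powr \<alpha>) \<partial>lborel)
        = ennreal (W * r powr (hdim TYPE('n) + \<alpha>))"
    using heis_ball_pow_weight[OF assms(4)] by blast
  interpret heis_morrey "TYPE('n)" p l \<alpha> W
  proof
    have "p * (- 1 / p) \<le> p * l" using assms(1,2) by (intro mult_left_mono) auto
    then show "0 \<le> 1 + p * l" using assms(1) by simp
  qed (use assms W in auto)
  define a where "a y = enn2real (heis_matnorm (A y))" for y
  have \<Phi>: "\<Phi> \<in> borel_measurable lebesgue"
    by (rule locally_integrable_measurable) fact
  have a: "a \<in> borel_measurable lebesgue"
    using assms(7) unfolding a_def by measurable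
  have good: "AE y in lborel. \<Phi> y \<noteq> 0 \<longrightarrow> heis_matnorm (A y) \<noteq> \<infinity> \<and> quasi_dilation C0 (a y) (A y)"
    using assms(8) unfolding AE_completion_iff
  proof eventually_elim
    case (elim y)
    show ?case
    proof
      assume "\<Phi> y \<noteq> 0"
      then have y: "y \<in> supp \<Phi>"
        unfolding supp_def by (intro subsetD[OF closure_subset]) simp
      then have "det (A y) \<noteq> 0" using elim by simp
      then show "heis_matnorm (A y) \<noteq> \<infinity> \<and> quasi_dilation C0 (a y) (A y)"
        unfolding a_def using quasi_dilation_matnorm assms(9)[OF y] by blast
    qed
  qed
  then have qd: "AE y in lborel. \<Phi> y \<noteq> 0 \<longrightarrow> quasi_dilation C0 (a y) (A y)"
    by eventually_elim blast
  have "(\<integral>\<^sup>+y. ennreal (\<Phi> y / heis_norm y ^ heis_dim TYPE('n))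
          * ennreal_powr (heis_matnorm (A y)) ((real (heis_dim TYPE('n)) + \<alpha>) * l) \<partial>lebesgue)
      = (\<integral>\<^sup>+y. ennreal (\<Phi> y / heis_norm y ^ heis_dim TYPE('n) * a y powr (\<gamma> * l)) \<partial>lborel)"
    unfolding nn_integral_completion
  proof (rule nn_integral_cong_AE)
    show "AE y in lborel. ennreal (\<Phi> y / heis_norm y ^ heis_dim TYPE('n))
          * ennreal_powr (heis_matnorm (A y)) ((real (heis_dim TYPE('n)) + \<alpha>) * l)
        = ennreal (\<Phi> y / heis_norm y ^ heis_dim TYPE('n) * a y powr (\<gamma> * l))"
      using good
    proof eventually_elim
      case (elim y)
      show ?case
      proof (cases "\<Phi> y = 0")
        case False
        then have "heis_matnorm (A y) = ennreal (a y)" "0 < a y"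
          using elim by (auto simp: a_def less_top dest: quasi_dilationD)
        then show ?thesis
          using assms(6)[of y] by (simp add: ennreal_powr_ennreal \<gamma>_def flip: ennreal_mult)
      qed simp
    qed
  qed
  then show ?thesis
    using hausdorff_bounded_if_integral_finite[OF \<Phi> assms(6,7) qd[unfolded a_def]]
      integral_finite_if_hausdorff_bounded[OF \<Phi> assms(6) a qd]
    unfolding a_def nn_integral_completion by auto
qed

end
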